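(* Let $V$ be a locally linearly compact vector space over a discrete field $\mathbb{K}$, $\phi:V\to V$ a continuous endomorphism, $W$ a closed $\phi$-invariant linear subspace of $V$ (i.e. $\phi W\leq W$) and $\overline{\phi}:V/W\to V/W$ the continuous endomorphism induced by $\phi$. Then $$\mathrm{ent}^*(\phi)=\mathrm{ent}^*(\phi\restriction_W)+\mathrm{ent}^*(\overline{\phi}).$$
   Context: $\mathbb{K}$ is an arbitrary field with the discrete topology. A Hausdorff topological $\mathbb{K}$-vector space is linearly topologized if it has a neighborhood basis at $0$ consisting of linear subspaces. A linear variety is a coset $v+W$ of a linear subspace $W$; it is closed if $W$ is closed. A linearly topologized vector space is linearly compact if every collection of closed linear varieties with the finite intersection property has non-empty intersection. A topological $\mathbb{K}$-vector space $V$ is locally linearly compact if it has a neighborhood basis at $0$ consisting of linearly compact open linear subspaces; $\mathcal{B}(V)$ denotes the set of all linearly compact open linear subspaces of $V$. Closed linear subspaces (with the induced topology) and quotients by closed linear subspaces (with the quotient topology) of locally linearly compact vector spaces are locally linearly compact. A continuous endomorphism is a continuous $\mathbb{K}$-linear map $V\to V$. For a continuous endomorphism $\phi:V\to V$, $U\in\mathcal{B}(V)$ and $n\geq 1$, let $C_n(\phi,U)=U\cap\phi^{-1}U\cap\ldots\cap\phi^{-n+1}U$ (the quotient $U/C_n(\phi,U)$ is finite-dimensional). Define $H^*(\phi,U)=\lim_{n\to\infty}\frac{1}{n}\dim\frac{U}{C_n(\phi,U)}$ (this limit exists) and the topological entropy $\mathrm{ent}^*(\phi)=\sup\{H^*(\phi,U)\mid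 U\in\mathcal{B}(V)\}\in\mathbb{N}\cup\{\infty\}$. *)

theory Defs
  imports
    "HOL-Analysis.Analysis"
    "HOL-Algebra.AbelCoset"
    "Jordan_Normal_Form.Missing_VectorSpace"
begin

section \<open>Quotient spaces\<close>

text \<open>The elements of \<open>V/W\<close> are the cosets of \<open>W\<close>, as for \<^const>\<open>A_FactGroup\<close>.
  The \<open>mult\<close> and \<open>one\<close> fields of a module record play no role for a vector space.\<close>

definition quotient_space ::
    "('k, 'v, 'm) module_scheme \<Rightarrow> 'v set \<Rightarrow> ('k, 'v set) module" where
  "quotient_space V W =
     \<lparr>carrier = a_rcosets\<^bsub>V\<^esub> W, mult = undefined, one = undefined,
      zero = W, add = set_add V,
      smult = (\<lambda>a A. \<Union>x\<in>A. W +>\<^bsub>V\<^esub> (a \<odot>\<^bsub>V\<^esub> x))\<rparr>"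

definition quotient_topology ::
    "('k, 'v, 'm) module_scheme \<Rightarrow> 'v topology \<Rightarrow> 'v set \<Rightarrow> 'v set topology" where
  "quotient_topology V T W =
     topology (\<lambda>S. S \<subseteq> a_rcosets\<^bsub>V\<^esub> W \<and> openin T {v \<in> topspace T. W +>\<^bsub>V\<^esub> v \<in> S})"

definition quotient_endomorphism ::
    "('k, 'v, 'm) module_scheme \<Rightarrow> 'v set \<Rightarrow> ('v \<Rightarrow> 'v) \<Rightarrow> 'v set \<Rightarrow> 'v set" where
  "quotient_endomorphism V W \<phi> A = (\<Union>x\<in>A. W +>\<^bsub>V\<^esub> \<phi> x)"

lemma istopology_quotient:
  "istopology (\<lambda>S. S \<subseteq> a_rcosets\<^bsub>V\<^esub> W \<and> openin T {v \<in> topspace T. W +>\<^bsub>V\<^esub> v \<in> S})"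
proof -
  have "{v \<in> topspace T. W +>\<^bsub>V\<^esub> v \<in> A \<inter> B} =
      {v \<in> topspace T. W +>\<^bsub>V\<^esub> v \<in> A} \<inter> {v \<in> topspace T. W +>\<^bsub>V\<^esub> v \<in> B}" for A B
    by blast
  moreover have "{v \<in> topspace T. W +>\<^bsub>V\<^esub> v \<in> \<Union>\<A>} =
      (\<Union>A\<in>\<A>. {v \<in> topspace T. W +>\<^bsub>V\<^esub> v \<in> A})" for \<A>
    by blast
  ultimately show ?thesis
    unfolding istopology_def by (auto intro!: openin_Union)
qed

lemma quotient_map_quotient_topology:
  assumes "topspace T = carrier V"
  shows "quotient_map T (quotient_topology V T W) (\<lambda>v. W +>\<^bsub>V\<^esub> v)"
proof -
  have op: "openin (quotient_topology V T W) S \<longleftrightarrow>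
      S \<subseteq> a_rcosets\<^bsub>V\<^esub> W \<and> openin T {v \<in> topspace T. W +>\<^bsub>V\<^esub> v \<in> S}" for S
    unfolding quotient_topology_def by (simp add: istopology_quotient topology_inverse')
  have im: "(\<lambda>v. W +>\<^bsub>V\<^esub> v) ` topspace T = a_rcosets\<^bsub>V\<^esub> W"
    by (auto simp: assms A_RCOSETS_def' a_r_coset_def)
  have "{v \<in> topspace T. W +>\<^bsub>V\<^esub> v \<in> a_rcosets\<^bsub>V\<^esub> W} = topspace T"
    using im by blast
  then have ts: "topspace (quotient_topology V T W) = a_rcosets\<^bsub>V\<^esub> W"
    using op[of "a_rcosets\<^bsub>V\<^esub> W"] op by (metis openin_subset openin_topspace subset_antisym subset_refl)
  show ?thesis
    unfolding quotient_map_def ts im by (simp add: op)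
qed


section \<open>Linearly compact and locally linearly compact spaces\<close>

text \<open>The scalar field carries the discrete topology.\<close>

definition topological_vectorspace ::
    "('k, 'l) ring_scheme \<Rightarrow> ('k, 'v, 'm) module_scheme \<Rightarrow> 'v topology \<Rightarrow> bool" where
  "topological_vectorspace K V T \<longleftrightarrow>
     vectorspace K V \<and> topspace T = carrier V \<and>
     continuous_map (prod_topology T T) T (\<lambda>(v, w). v \<oplus>\<^bsub>V\<^esub> w) \<and>
     continuous_map (prod_topology (discrete_topology (carrier K)) T) T (\<lambda>(a, v). a \<odot>\<^bsub>V\<^esub> v)"

definition linearly_topologized ::
    "('k, 'l) ring_scheme \<Rightarrow> ('k, 'v, 'm) module_scheme \<Rightarrow> 'v topology \<Rightarrow> bool" where
  "linearly_topologized K V T \<longleftrightarrow>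
     topological_vectorspace K V T \<and> Hausdorff_space T \<and>
     neighbourhood_base_at \<zero>\<^bsub>V\<^esub> (\<lambda>W. VectorSpace.subspace K W V) T"

definition closed_linear_variety ::
    "('k, 'l) ring_scheme \<Rightarrow> ('k, 'v, 'm) module_scheme \<Rightarrow> 'v topology \<Rightarrow> 'v set \<Rightarrow> bool" where
  "closed_linear_variety K V T A \<longleftrightarrow>
     (\<exists>v\<in>carrier V. \<exists>W. VectorSpace.subspace K W V \<and> closedin T W \<and> A = W +>\<^bsub>V\<^esub> v)"

text \<open>Intersections are taken inside \<open>V\<close>, so that the empty collection has intersection \<open>V\<close>.\<close>

definition linearly_compact ::
    "('k, 'l) ring_scheme \<Rightarrow> ('k, 'v, 'm) module_scheme \<Rightarrow> 'v topology \<Rightarrow> bool" where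
  "linearly_compact K V T \<longleftrightarrow>
     linearly_topologized K V T \<and>
     (\<forall>\<A>. (\<forall>A\<in>\<A>. closed_linear_variety K V T A) \<and>
           (\<forall>\<F>. finite \<F> \<and> \<F> \<subseteq> \<A> \<longrightarrow> carrier V \<inter> \<Inter>\<F> \<noteq> {}) \<longrightarrow>
           carrier V \<inter> \<Inter>\<A> \<noteq> {})"

text \<open>The set \<open>\<B>(V)\<close>.\<close>

definition lc_open_subspaces ::
    "('k, 'l) ring_scheme \<Rightarrow> ('k, 'v, 'm) module_scheme \<Rightarrow> 'v topology \<Rightarrow> 'v set set" where
  "lc_open_subspaces K V T =
     {U. VectorSpace.subspace K U V \<and> openin T U \<and>
         linearly_compact K (V\<lparr>carrier := U\<rparr>) (subtopology T U)}"

text \<open>The Hausdorff property is not listed separately: it follows from that of a single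
  member of \<open>\<B>(V)\<close>, which is an open subgroup.\<close>

definition locally_linearly_compact ::
    "('k, 'l) ring_scheme \<Rightarrow> ('k, 'v, 'm) module_scheme \<Rightarrow> 'v topology \<Rightarrow> bool" where
  "locally_linearly_compact K V T \<longleftrightarrow>
     topological_vectorspace K V T \<and>
     neighbourhood_base_at \<zero>\<^bsub>V\<^esub> (\<lambda>U. U \<in> lc_open_subspaces K V T) T"

definition continuous_endomorphism ::
    "('k, 'l) ring_scheme \<Rightarrow> ('k, 'v, 'm) module_scheme \<Rightarrow> 'v topology \<Rightarrow> ('v \<Rightarrow> 'v) \<Rightarrow> bool" where
  "continuous_endomorphism K V T \<phi> \<longleftrightarrow> linear_map K V V \<phi> \<and> continuous_map T T \<phi>"


section \<open>Topological entropy\<close>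

text \<open>The preimages are taken under the total function \<open>\<phi>\<close>; this is harmless because
  of the intersection with \<open>U\<close>.\<close>

definition cotrajectory :: "('v \<Rightarrow> 'v) \<Rightarrow> 'v set \<Rightarrow> nat \<Rightarrow> 'v set" where
  "cotrajectory \<phi> U n = U \<inter> (\<Inter>i\<in>{1..<n}. (\<phi> ^^ i) -` U)"

text \<open>\<^const>\<open>vectorspace.dim\<close> is meaningful only for finite-dimensional spaces;
  the quotients by cotrajectories are finite-dimensional when \<open>\<phi>\<close> is a continuous
  endomorphism and \<open>U \<in> \<B>(V)\<close>.\<close>

definition local_entropy ::
    "('k, 'l) ring_scheme \<Rightarrow> ('k, 'v, 'm) module_scheme \<Rightarrow> ('v \<Rightarrow> 'v) \<Rightarrow> 'v set \<Rightarrow> real" where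
  "local_entropy K V \<phi> U =
     lim (\<lambda>n. 1 / real n *
       real (vectorspace.dim K (quotient_space (V\<lparr>carrier := U\<rparr>) (cotrajectory \<phi> U n))))"

definition topological_entropy ::
    "('k, 'l) ring_scheme \<Rightarrow> ('k, 'v, 'm) module_scheme \<Rightarrow> 'v topology \<Rightarrow> ('v \<Rightarrow> 'v) \<Rightarrow> ereal" where
  "topological_entropy K V T \<phi> =
     (SUP U\<in>lc_open_subspaces K V T. ereal (local_entropy K V \<phi> U))"

end

theory Submission
  imports Defs
begin

text \<open>Write \<open>C\<^sub>n\<close> for cotrajectories and \<open>p : V \<rightarrow> V/W\<close>. Refining \<open>U\<close> increases \<open>H\<^sup>*(\<phi>, U)\<close>, and for
  \<open>U \<in> \<B>(V)\<close> the dimension of \<open>U / C\<^sub>n(\<phi>, U)\<close> is at least the sum of those of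
  \<open>(U \<inter> W) / C\<^sub>n(\<phi>, U \<inter> W)\<close> and \<open>p U / C\<^sub>n(\<psi>, p U)\<close>, where \<open>\<psi>\<close> is the induced map; since \<open>U\<close> can be
  chosen with \<open>U \<inter> W\<close> and \<open>p U\<close> as small as desired, \<open>\<ge>\<close> follows. For \<open>\<le>\<close> one follows Bowen: choose
  \<open>U' \<in> \<B>(V)\<close> inside \<open>C\<^sub>m\<^sub>+\<^sub>1(\<phi>, U)\<close> and cut the trajectory of a point of \<open>U\<close> into blocks of length \<open>m\<close>.
  If the trajectory stays in \<open>p U'\<close> modulo \<open>W\<close>, each block imposes at most
  \<open>dim (U \<inter> W) / C\<^sub>m\<^sub>+\<^sub>1(\<phi>, U \<inter> W)\<close> conditions, so
  \<open>H\<^sup>*(\<phi>, U) \<le> H\<^sup>*(\<psi>, p U') + 1/m \<cdot> dim (U \<inter> W) / C\<^sub>m\<^sub>+\<^sub>1(\<phi>, U \<inter> W)\<close>; now let \<open>m\<close> tend to infinity.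
  Topology enters only through the finiteness of the dimensions involved.\<close>

section \<open>Quotients and codimension\<close>

text \<open>The upper bound is the harder half because \<open>p\<close> maps a cotrajectory of
  \<open>U\<close> into the cotrajectory of the image of \<open>U\<close>, but perhaps not onto it:
  a point that stays in U + W is corrected by an element of \<open>W\<close> at each time, and these
  corrections need not form a trajectory in \<open>W\<close>. Counting along U \<inter> W and the
  image of \<open>U\<close> therefore yields only the lower bound. Choosing \<open>U'\<close> inside
  the cotrajectory of length m + 1 repairs this: if y in \<open>U\<close> differs from some u in
  \<open>U'\<close> by an element of \<open>W\<close>, then u stays in \<open>U\<close> for m
  further steps by itself, so whether y does so depends only on y - u in U \<inter> W. Consecutive
  blocks share an endpoint. Hence a block of m steps is measured by a cotrajectory of length m + 1,
  and the division is by m, which does not change the limit.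

  All counting uses dim A/B for subspaces B \<subseteq> A, with two tools: additivity along a chain
  and comparison through a linear map. As \<open>dim\<close> is meaningful only in finite dimension,
  each use carries a \<open>fin_codim\<close> hypothesis.\<close>

lemma a_r_coset_eq: "W +>\<^bsub>V\<^esub> v = (\<lambda>w. w \<oplus>\<^bsub>V\<^esub> v) ` W"
  by (auto simp: a_r_coset_def r_coset_def)

lemma set_add_eq: "A <+>\<^bsub>V\<^esub> B = (\<Union>a\<in>A. (\<lambda>b. a \<oplus>\<^bsub>V\<^esub> b) ` B)"
  by (auto simp: set_add_def set_mult_def)

lemma a_rcosets_eq: "a_rcosets\<^bsub>V\<^esub> W = (\<lambda>v. W +>\<^bsub>V\<^esub> v) ` carrier V"
  by (auto simp: A_RCOSETS_def' a_r_coset_def)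

lemma quotient_space_simps [simp]:
  "carrier (quotient_space V W) = (\<lambda>v. W +>\<^bsub>V\<^esub> v) ` carrier V"
  "zero (quotient_space V W) = W"
  "add (quotient_space V W) = set_add V"
  "smult (quotient_space V W) = (\<lambda>a A. \<Union>x\<in>A. W +>\<^bsub>V\<^esub> (a \<odot>\<^bsub>V\<^esub> x))"
  by (simp_all add: quotient_space_def a_rcosets_eq)

lemma a_r_coset_carrier_update [simp]: "W +>\<^bsub>V\<lparr>carrier := A\<rparr>\<^esub> v = W +>\<^bsub>V\<^esub> v"
  by (simp add: a_r_coset_eq)

lemma set_add_carrier_update [simp]: "set_add (V\<lparr>carrier := A\<rparr>) = set_add V"
  by (intro ext) (simp add: set_add_eq)

text \<open>The operations of a quotient record do not consult the carrier of \<open>V\<close>. A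
  kernel inside A/C is thus literally the record B/C, with no isomorphism to transport
  along.\<close>

lemma quotient_space_carrier_update:
  "quotient_space (V\<lparr>carrier := A\<rparr>) W =
    (quotient_space V W)\<lparr>carrier := (\<lambda>v. W +>\<^bsub>V\<^esub> v) ` A\<rparr>"
  by (simp add: quotient_space_def a_rcosets_eq)

section \<open>Subspaces, differences and cosets\<close>

context vectorspace
begin

lemma subspaceI:
  assumes "S \<subseteq> carrier V" "\<zero>\<^bsub>V\<^esub> \<in> S"
    and "\<And>v w. v \<in> S \<Longrightarrow> w \<in> S \<Longrightarrow> v \<oplus>\<^bsub>V\<^esub> w \<in> S"
    and "\<And>a v. a \<in> carrier K \<Longrightarrow> v \<in> S \<Longrightarrow> a \<odot>\<^bsub>V\<^esub> v \<in> S"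
  shows "VectorSpace.subspace K S V"
  using assms by (simp add: VectorSpace.subspace_def submodule_def vectorspace_axioms module_axioms)

lemma subspaceD:
  assumes "VectorSpace.subspace K S V"
  shows "S \<subseteq> carrier V" "\<zero>\<^bsub>V\<^esub> \<in> S"
    and "\<And>v w. v \<in> S \<Longrightarrow> w \<in> S \<Longrightarrow> v \<oplus>\<^bsub>V\<^esub> w \<in> S"
    and "\<And>a v. a \<in> carrier K \<Longrightarrow> v \<in> S \<Longrightarrow> a \<odot>\<^bsub>V\<^esub> v \<in> S"
    and "\<And>v. v \<in> S \<Longrightarrow> \<ominus>\<^bsub>V\<^esub> v \<in> S"
    and "\<And>v w. v \<in> S \<Longrightarrow> w \<in> S \<Longrightarrow> v \<ominus>\<^bsub>V\<^esub> w \<in> S"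
proof -
  show 1: "S \<subseteq> carrier V" "\<zero>\<^bsub>V\<^esub> \<in> S"
    and 2: "\<And>v w. v \<in> S \<Longrightarrow> w \<in> S \<Longrightarrow> v \<oplus>\<^bsub>V\<^esub> w \<in> S"
    and 3: "\<And>a v. a \<in> carrier K \<Longrightarrow> v \<in> S \<Longrightarrow> a \<odot>\<^bsub>V\<^esub> v \<in> S"
    using assms by (auto simp: VectorSpace.subspace_def submodule_def)
  show 4: "\<ominus>\<^bsub>V\<^esub> v \<in> S" if "v \<in> S" for v
    using 1 3[of "\<ominus>\<^bsub>K\<^esub> \<one>\<^bsub>K\<^esub>" v] that by (auto simp: smult_minus_1)
  show "v \<ominus>\<^bsub>V\<^esub> w \<in> S" if "v \<in> S" "w \<in> S" for v w
    using 2[OF that(1) 4[OF that(2)]] by (simp add: a_minus_def)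
qed

lemma subspace_carrier_update:
  assumes "VectorSpace.subspace K A V"
  shows "VectorSpace.subspace K B (V\<lparr>carrier := A\<rparr>) \<longleftrightarrow>
    VectorSpace.subspace K B V \<and> B \<subseteq> A"
proof -
  interpret A: vectorspace K "V\<lparr>carrier := A\<rparr>"
    by (rule subspace_is_vs[OF assms])
  show ?thesis
    using subspaceD(1)[OF assms]
    by (auto simp: VectorSpace.subspace_def submodule_def vectorspace_axioms module_axioms
        A.vectorspace_axioms A.module_axioms)
qed

lemma subspace_Int:
  assumes "VectorSpace.subspace K A V" "VectorSpace.subspace K B V"
  shows "VectorSpace.subspace K (A \<inter> B) V"
  using subspaceD[OF assms(1)] subspaceD[OF assms(2)] by (intro subspaceI) auto

lemma diff_add_cancel: "x \<in> carrier V \<Longrightarrow> v \<in> carrier V \<Longrightarrow> (x \<ominus>\<^bsub>V\<^esub> v) \<oplus>\<^bsub>V\<^esub> v = x"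
  by (simp add: a_minus_def a_assoc l_neg)

lemma add_diff_cancel: "x \<in> carrier V \<Longrightarrow> v \<in> carrier V \<Longrightarrow> (x \<oplus>\<^bsub>V\<^esub> v) \<ominus>\<^bsub>V\<^esub> v = x"
  by (simp add: a_minus_def a_assoc r_neg)

lemma diff_diff_cancel:
  assumes "x \<in> carrier V" "y \<in> carrier V"
  shows "x \<ominus>\<^bsub>V\<^esub> (x \<ominus>\<^bsub>V\<^esub> y) = y"
  using assms by (metis M.a_comm M.minus_closed add_diff_cancel diff_add_cancel)

lemma diff_zero: "x \<in> carrier V \<Longrightarrow> x \<ominus>\<^bsub>V\<^esub> \<zero>\<^bsub>V\<^esub> = x"
  using diff_add_cancel[of x "\<zero>\<^bsub>V\<^esub>"] by simp

lemma diff_self: "x \<in> carrier V \<Longrightarrow> x \<ominus>\<^bsub>V\<^esub> x = \<zero>\<^bsub>V\<^esub>"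
  by simp

lemma diff_add_diff:
  assumes "x \<in> carrier V" "y \<in> carrier V" "z \<in> carrier V"
  shows "(x \<ominus>\<^bsub>V\<^esub> y) \<oplus>\<^bsub>V\<^esub> (y \<ominus>\<^bsub>V\<^esub> z) = x \<ominus>\<^bsub>V\<^esub> z"
  using assms by (metis M.minus_closed M.minus_eq M.a_assoc M.a_inv_closed diff_add_cancel)

lemma diff_swap:
  assumes "x \<in> carrier V" "y \<in> carrier V"
  shows "\<ominus>\<^bsub>V\<^esub> (x \<ominus>\<^bsub>V\<^esub> y) = y \<ominus>\<^bsub>V\<^esub> x"
  using assms by (simp add: a_minus_def minus_add M.a_comm)

lemma smult_diff:
  assumes "a \<in> carrier K" "x \<in> carrier V" "y \<in> carrier V"
  shows "a \<odot>\<^bsub>V\<^esub> (x \<ominus>\<^bsub>V\<^esub> y) = a \<odot>\<^bsub>V\<^esub> x \<ominus>\<^bsub>V\<^esub> a \<odot>\<^bsub>V\<^esub> y"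
  using assms
  by (metis M.minus_closed add_diff_cancel diff_add_cancel smult_closed smult_r_distr)

lemma add_diff_add:
  assumes "x \<in> carrier V" "y \<in> carrier V" "x' \<in> carrier V" "y' \<in> carrier V"
  shows "(x \<oplus>\<^bsub>V\<^esub> y) \<ominus>\<^bsub>V\<^esub> (x' \<oplus>\<^bsub>V\<^esub> y') = (x \<ominus>\<^bsub>V\<^esub> x') \<oplus>\<^bsub>V\<^esub> (y \<ominus>\<^bsub>V\<^esub> y')"
  using assms by (simp add: a_minus_def minus_add M.a_ac)

context
  fixes W assumes W: "VectorSpace.subspace K W V"
begin

lemma mem_coset_iff:
  assumes v: "v \<in> carrier V"
  shows "x \<in> W +>\<^bsub>V\<^esub> v \<longleftrightarrow> x \<in> carrier V \<and> x \<ominus>\<^bsub>V\<^esub> v \<in> W"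
  using subspaceD[OF W] v
  by (auto simp: a_r_coset_eq add_diff_cancel subset_iff diff_add_cancel image_iff intro!: bexI[of _ "x \<ominus>\<^bsub>V\<^esub> v"])

lemma mem_coset_self: "v \<in> carrier V \<Longrightarrow> v \<in> W +>\<^bsub>V\<^esub> v"
  using subspaceD(2)[OF W] by (simp add: mem_coset_iff diff_self)

lemma coset_eq_iff:
  assumes "u \<in> carrier V" "v \<in> carrier V"
  shows "W +>\<^bsub>V\<^esub> u = W +>\<^bsub>V\<^esub> v \<longleftrightarrow> u \<ominus>\<^bsub>V\<^esub> v \<in> W"
proof
  assume "W +>\<^bsub>V\<^esub> u = W +>\<^bsub>V\<^esub> v"
  then show "u \<ominus>\<^bsub>V\<^esub> v \<in> W"
    using mem_coset_self[OF assms(1)] mem_coset_iff[OF assms(2)] by auto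
next
  assume d: "u \<ominus>\<^bsub>V\<^esub> v \<in> W"
  have d': "v \<ominus>\<^bsub>V\<^esub> u \<in> W"
    using subspaceD(5)[OF W d] assms by (simp add: diff_swap)
  have "x \<ominus>\<^bsub>V\<^esub> u \<in> W \<longleftrightarrow> x \<ominus>\<^bsub>V\<^esub> v \<in> W" if "x \<in> carrier V" for x
    using subspaceD(3)[OF W _ d, of "x \<ominus>\<^bsub>V\<^esub> u"] subspaceD(3)[OF W _ d', of "x \<ominus>\<^bsub>V\<^esub> v"]
      diff_add_diff that assms by auto
  then show "W +>\<^bsub>V\<^esub> u = W +>\<^bsub>V\<^esub> v"
    using assms by (auto simp: mem_coset_iff)
qed

lemma coset_eq_self_iff:
  assumes "u \<in> carrier V"
  shows "W +>\<^bsub>V\<^esub> u = W \<longleftrightarrow> u \<in> W"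
proof -
  have "W +>\<^bsub>V\<^esub> \<zero>\<^bsub>V\<^esub> = W"
    using subspaceD(1)[OF W] by (force simp: a_r_coset_eq)
  then show ?thesis
    using coset_eq_iff[OF assms, of "\<zero>\<^bsub>V\<^esub>"] assms by (simp add: diff_zero)
qed

lemma coset_zero: "W +>\<^bsub>V\<^esub> \<zero>\<^bsub>V\<^esub> = W"
  using coset_eq_self_iff subspaceD(2)[OF W] by simp

lemma coset_add:
  assumes "u \<in> carrier V" "v \<in> carrier V"
  shows "(W +>\<^bsub>V\<^esub> u) <+>\<^bsub>V\<^esub> (W +>\<^bsub>V\<^esub> v) = W +>\<^bsub>V\<^esub> (u \<oplus>\<^bsub>V\<^esub> v)"
proof -
  have "z \<in> (W +>\<^bsub>V\<^esub> u) <+>\<^bsub>V\<^esub> (W +>\<^bsub>V\<^esub> v) \<longleftrightarrow> z \<in> W +>\<^bsub>V\<^esub> (u \<oplus>\<^bsub>V\<^esub> v)" for z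
  proof
    assume "z \<in> (W +>\<^bsub>V\<^esub> u) <+>\<^bsub>V\<^esub> (W +>\<^bsub>V\<^esub> v)"
    then obtain x y where "x \<in> W +>\<^bsub>V\<^esub> u" "y \<in> W +>\<^bsub>V\<^esub> v" "z = x \<oplus>\<^bsub>V\<^esub> y"
      by (auto simp: set_add_eq)
    then show "z \<in> W +>\<^bsub>V\<^esub> (u \<oplus>\<^bsub>V\<^esub> v)"
      using assms subspaceD(3)[OF W] by (auto simp: mem_coset_iff add_diff_add)
  next
    assume "z \<in> W +>\<^bsub>V\<^esub> (u \<oplus>\<^bsub>V\<^esub> v)"
    then obtain w where w: "w \<in> W" "z = w \<oplus>\<^bsub>V\<^esub> (u \<oplus>\<^bsub>V\<^esub> v)"
      by (auto simp: a_r_coset_eq)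
    then have "z = (w \<oplus>\<^bsub>V\<^esub> u) \<oplus>\<^bsub>V\<^esub> v"
      using assms subspaceD(1)[OF W] M.a_assoc by (metis subsetD)
    moreover have "w \<oplus>\<^bsub>V\<^esub> u \<in> W +>\<^bsub>V\<^esub> u"
      using w by (auto simp: a_r_coset_eq)
    ultimately show "z \<in> (W +>\<^bsub>V\<^esub> u) <+>\<^bsub>V\<^esub> (W +>\<^bsub>V\<^esub> v)"
      using mem_coset_self[OF assms(2)] by (auto simp: set_add_eq)
  qed
  then show ?thesis by blast
qed

end

end

lemma UN_eq_const: "x \<in> A \<Longrightarrow> (\<And>y. y \<in> A \<Longrightarrow> f y = c) \<Longrightarrow> (\<Union>y\<in>A. f y) = c"
  by blast

text \<open>The union avoids choosing a representative: when \<open>f\<close> respects the two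
  subspaces, all its members coincide on a coset. Source and target may differ, so that one notion
  serves inclusions, projections and \<open>quotient_endomorphism\<close>.\<close>

definition induced_map ::
    "('k, 'v, 'm) module_scheme \<Rightarrow> 'v set \<Rightarrow> ('u \<Rightarrow> 'v) \<Rightarrow> 'u set \<Rightarrow> 'v set" where
  "induced_map V W f A = (\<Union>x\<in>A. W +>\<^bsub>V\<^esub> f x)"

lemma quotient_endomorphism_eq: "quotient_endomorphism V W = induced_map V W"
  by (intro ext) (simp add: quotient_endomorphism_def induced_map_def)

lemma linear_mapI:
  assumes "vectorspace K V" "vectorspace K V'" "f \<in> carrier V \<rightarrow> carrier V'"
    and "\<And>u v. u \<in> carrier V \<Longrightarrow> v \<in> carrier V \<Longrightarrow> f (u \<oplus>\<^bsub>V\<^esub> v) = f u \<oplus>\<^bsub>V'\<^esub> f v"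
    and "\<And>a v. a \<in> carrier K \<Longrightarrow> v \<in> carrier V \<Longrightarrow> f (a \<odot>\<^bsub>V\<^esub> v) = a \<odot>\<^bsub>V'\<^esub> f v"
  shows "linear_map K V V' f"
proof -
  interpret V: vectorspace K V by fact
  interpret V': vectorspace K V' by fact
  show ?thesis
    by unfold_locales (use assms in \<open>auto simp: module_hom_def\<close>)
qed

lemma (in linear_map) f_closed: "v \<in> carrier V \<Longrightarrow> T v \<in> carrier W"
  using f_hom by (auto simp: module_hom_def)

lemma (in linear_map) subspace_vimage:
  assumes U: "VectorSpace.subspace K U W"
  shows "VectorSpace.subspace K {v \<in> carrier V. T v \<in> U} V"
  using W.subspaceD[OF U] by (intro V.subspaceI) auto

lemma (in linear_map) subspace_image:
  assumes U: "VectorSpace.subspace K U V"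
  shows "VectorSpace.subspace K (T ` U) W"
proof (rule W.subspaceI)
  note U' = V.subspaceD[OF U]
  show "T ` U \<subseteq> carrier W" using U' f_closed by auto
  show "\<zero>\<^bsub>W\<^esub> \<in> T ` U" using U' T0_is_0 by (metis image_eqI)
  show "v \<oplus>\<^bsub>W\<^esub> w \<in> T ` U" if "v \<in> T ` U" "w \<in> T ` U" for v w
    using that U' T_add by (smt (verit) image_iff subsetD)
  show "a \<odot>\<^bsub>W\<^esub> v \<in> T ` U" if "a \<in> carrier K" "v \<in> T ` U" for a v
    using that U' T_smult by (smt (verit) image_iff subsetD)
qed

lemma (in linear_map) induced_map_coset:
  assumes W: "VectorSpace.subspace K A V" and W': "VectorSpace.subspace K B W"
    and "T ` A \<subseteq> B" and v: "v \<in> carrier V"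
  shows "induced_map W B T (A +>\<^bsub>V\<^esub> v) = B +>\<^bsub>W\<^esub> T v"
proof -
  have "B +>\<^bsub>W\<^esub> T x = B +>\<^bsub>W\<^esub> T v" if x: "x \<in> A +>\<^bsub>V\<^esub> v" for x
  proof -
    have "x \<in> carrier V" "x \<ominus>\<^bsub>V\<^esub> v \<in> A"
      using x v V.mem_coset_iff[OF W] by auto
    moreover then have "T x \<ominus>\<^bsub>W\<^esub> T v \<in> B"
      using v assms(3) T_minus[of x v] by (metis image_subset_iff)
    ultimately show ?thesis
      using v W.coset_eq_iff[OF W'] f_closed by auto
  qed
  then show ?thesis
    unfolding induced_map_def by (rule UN_eq_const[OF V.mem_coset_self[OF W v]])
qed

lemma (in vectorspace) linear_map_id: "linear_map K V V id"
  by (intro linear_mapI) (auto simp: vectorspace_axioms)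

lemma (in vectorspace) quotient_smult:
  assumes W: "VectorSpace.subspace K W V" and a: "a \<in> carrier K" and v: "v \<in> carrier V"
  shows "a \<odot>\<^bsub>quotient_space V W\<^esub> (W +>\<^bsub>V\<^esub> v) = W +>\<^bsub>V\<^esub> (a \<odot>\<^bsub>V\<^esub> v)"
proof -
  have "W +>\<^bsub>V\<^esub> (a \<odot>\<^bsub>V\<^esub> x) = W +>\<^bsub>V\<^esub> (a \<odot>\<^bsub>V\<^esub> v)" if "x \<in> W +>\<^bsub>V\<^esub> v" for x
    using that a v subspaceD(4)[OF W a, of "x \<ominus>\<^bsub>V\<^esub> v"]
    by (simp add: mem_coset_iff[OF W] coset_eq_iff[OF W] smult_diff)
  then show ?thesis
    unfolding quotient_space_simps by (rule UN_eq_const[OF mem_coset_self[OF W v]])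
qed

lemma (in vectorspace) quotient_vectorspace:
  assumes W: "VectorSpace.subspace K W V"
  shows "vectorspace K (quotient_space V W)"
proof -
  have "module K (quotient_space V W)"
  proof (rule module_criteria)
    show "cring K" by unfold_locales
    show "\<zero>\<^bsub>quotient_space V W\<^esub> \<in> carrier (quotient_space V W)"
      using coset_zero[OF W] by force
    show "\<forall>v\<in>carrier (quotient_space V W).
        v \<oplus>\<^bsub>quotient_space V W\<^esub> \<zero>\<^bsub>quotient_space V W\<^esub> = v"
      using coset_add[OF W, of _ "\<zero>\<^bsub>V\<^esub>"] by (auto simp: coset_zero[OF W])
    show "\<forall>v\<in>carrier (quotient_space V W). \<exists>u\<in>carrier (quotient_space V W).
        v \<oplus>\<^bsub>quotient_space V W\<^esub> u = \<zero>\<^bsub>quotient_space V W\<^esub>"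
      by (force simp: coset_add[OF W] r_neg coset_zero[OF W] intro!: bexI[of _ "\<ominus>\<^bsub>V\<^esub> _"])
  qed (use W in \<open>auto simp: coset_add quotient_smult smult_assoc1 smult_l_distr smult_r_distr
      M.a_ac coset_zero simp del: quotient_space_simps(4)
      intro: M.a_comm arg_cong[where f = "\<lambda>x. W +>\<^bsub>V\<^esub> x"]\<close>)
  then show ?thesis
    by (simp add: vectorspace_def field_axioms)
qed

lemma (in linear_map) linear_induced_map:
  assumes A: "VectorSpace.subspace K A V" and B: "VectorSpace.subspace K B W"
    and AB: "T ` A \<subseteq> B"
  shows "linear_map K (quotient_space V A) (quotient_space W B) (induced_map W B T)"
proof (rule linear_mapI)
  show "vectorspace K (quotient_space V A)" "vectorspace K (quotient_space W B)"
    using V.quotient_vectorspace A W.quotient_vectorspace B by auto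
qed (auto simp: induced_map_coset[OF assms] f_closed V.coset_add[OF A] W.coset_add[OF B] 
   V.quotient_smult[OF A] W.quotient_smult[OF B] simp del: quotient_space_simps(4))

lemma (in vectorspace) linear_coset_map:
  assumes W: "VectorSpace.subspace K W V"
  shows "linear_map K V (quotient_space V W) (\<lambda>v. W +>\<^bsub>V\<^esub> v)"
  by (rule linear_mapI)
    (auto simp: vectorspace_axioms quotient_vectorspace W coset_add quotient_smult
      simp del: quotient_space_simps(4))

lemma (in linear_map) linear_map_restrict:
  assumes A: "VectorSpace.subspace K A V" and B: "VectorSpace.subspace K B W"
    and AB: "T ` A \<subseteq> B"
  shows "linear_map K (V\<lparr>carrier := A\<rparr>) (W\<lparr>carrier := B\<rparr>) T"
  by (rule linear_mapI)
    (use V.subspaceD(1)[OF A] AB in \<open>auto simp: V.subspace_is_vs[OF A] W.subspace_is_vs[OF B] subset_iff\<close>)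

text \<open>Independence in \<open>S\<close> and in \<open>V\<close> agree, so independent subsets
  of \<open>S\<close> have at most \<open>dim\<close> elements; a maximal one exists and is a basis
  of \<open>S\<close>.\<close>

lemma (in vectorspace) fin_dim_subspace:
  assumes fd: "fin_dim" and S: "VectorSpace.subspace K S V"
  shows "vectorspace.fin_dim K (vs S)" "vectorspace.dim K (vs S) \<le> dim"
proof -
  interpret S: vectorspace K "vs S" by (rule subspace_is_vs[OF S])
  have sub: "submodule K S V" using S by simp
  have li: "S.lin_dep A \<longleftrightarrow> lin_dep A" if "A \<subseteq> S" for A
    using span_li_not_depend(2)[OF that sub] .
  have "\<exists>A. finite A \<and> maximal A (\<lambda>A. A \<subseteq> carrier (vs S) \<and> \<not> S.lin_dep A)"
  proof (rule maximal_exists[where N = dim and B = "{}"])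
    fix A assume "A \<subseteq> carrier (vs S) \<and> \<not> S.lin_dep A"
    then show "finite A \<and> card A \<le> dim"
      using li_le_dim[OF fd, of A] li[of A] subspaceD(1)[OF S] by auto
  next
    show "{} \<subseteq> carrier (vs S) \<and> \<not> S.lin_dep {}"
      by (auto simp: S.lin_dep_def)
  qed
  then obtain A where A: "finite A" "maximal A (\<lambda>A. A \<subseteq> carrier (vs S) \<and> \<not> S.lin_dep A)"
    by blast
  have "S.basis A" by (rule S.max_li_is_basis[OF A(2)])
  then have "A \<subseteq> S" "\<not> lin_dep A" "S.gen_set A"
    using li by (auto simp: S.basis_def)
  then show "S.fin_dim"
    using A(1) by (auto simp: S.fin_dim_def)
  have "S.dim = card A"
    by (rule S.dim_basis[OF A(1) \<open>S.basis A\<close>])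
  also have "\<dots> \<le> dim"
    using li_le_dim[OF fd, of A] \<open>A \<subseteq> S\<close> \<open>\<not> lin_dep A\<close> subspaceD(1)[OF S] by auto
  finally show "S.dim \<le> dim" .
qed

lemma (in linear_map) dim_le_of_inj:
  assumes V: "V.fin_dim" and W: "W.fin_dim" and "inj_on T (carrier V)"
  shows "V.dim \<le> W.dim"
  using rank_nullity[OF V] inj_imp_dim_ker0[OF assms(3)]
    W.fin_dim_subspace(2)[OF W imT_is_subspace] by simp

text \<open>Finiteness is a predicate of its own because the number \<open>codim\<close> is
  informative only where it holds.\<close>

definition fin_codim ::
  "('k, 'l) ring_scheme \<Rightarrow> ('k, 'v, 'm) module_scheme \<Rightarrow> 'v set \<Rightarrow> 'v set \<Rightarrow> bool" where
  "fin_codim K V A B = vectorspace.fin_dim K (quotient_space (V\<lparr>carrier := A\<rparr>) B)"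

definition codim ::
  "('k, 'l) ring_scheme \<Rightarrow> ('k, 'v, 'm) module_scheme \<Rightarrow> 'v set \<Rightarrow> 'v set \<Rightarrow> nat" where
  "codim K V A B = vectorspace.dim K (quotient_space (V\<lparr>carrier := A\<rparr>) B)"

text \<open>This allows dimensions belonging to the restriction of \<phi> to \<open>W\<close> to be
  computed inside \<open>V\<close>.\<close>

lemma codim_carrier_update [simp]:
  "codim K (V\<lparr>carrier := S\<rparr>) A B = codim K V A B"
  "fin_codim K (V\<lparr>carrier := S\<rparr>) A B = fin_codim K V A B"
  by (simp_all add: codim_def fin_codim_def)

lemma (in linear_map) linear_induced_map_restrict:
  assumes A: "VectorSpace.subspace K A V" and B: "VectorSpace.subspace K B V" and "B \<subseteq> A"
    and A': "VectorSpace.subspace K A' W" and B': "VectorSpace.subspace K B' W" and "B' \<subseteq> A'"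
    and "T ` A \<subseteq> A'" "T ` B \<subseteq> B'"
  shows "linear_map K (quotient_space (V\<lparr>carrier := A\<rparr>) B) (quotient_space (W\<lparr>carrier := A'\<rparr>) B')
      (induced_map W B' T)"
    and "\<And>x. x \<in> A \<Longrightarrow> induced_map W B' T (B +>\<^bsub>V\<^esub> x) = B' +>\<^bsub>W\<^esub> T x"
proof -
  interpret R: linear_map K "V\<lparr>carrier := A\<rparr>" "W\<lparr>carrier := A'\<rparr>" T
    by (rule linear_map_restrict) (use assms in auto)
  have "induced_map (W\<lparr>carrier := A'\<rparr>) B' T = induced_map W B' T"
    by (intro ext) (simp add: induced_map_def)
  then show "linear_map K (quotient_space (V\<lparr>carrier := A\<rparr>) B) (quotient_space (W\<lparr>carrier := A'\<rparr>) B')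
      (induced_map W B' T)"
    using R.linear_induced_map[of B B'] assms
    by (simp add: V.subspace_carrier_update W.subspace_carrier_update)
  show "induced_map W B' T (B +>\<^bsub>V\<^esub> x) = B' +>\<^bsub>W\<^esub> T x" if "x \<in> A" for x
    using induced_map_coset[of B B' x] assms that V.subspaceD(1)[OF A] by auto
qed

text \<open>The condition on \<open>B\<close> and \<open>B'\<close> makes the induced map from A/B
  to A'/B' well defined and injective; the extra premise of the second part makes it onto. It is
  applied to inclusions, to \<open>p\<close> and to iterates of \<phi>.\<close>

lemma (in linear_map) codim_mono:
  assumes A: "VectorSpace.subspace K A V" and B: "VectorSpace.subspace K B V" and BA: "B \<subseteq> A"
    and A': "VectorSpace.subspace K A' W" and B': "VectorSpace.subspace K B' W" and BA': "B' \<subseteq> A'"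
    and T: "T ` A \<subseteq> A'" "\<And>x. x \<in> A \<Longrightarrow> T x \<in> B' \<longleftrightarrow> x \<in> B"
    and fin: "fin_codim K V A B" 
  shows "fin_codim K W A' B' \<Longrightarrow> codim K V A B \<le> codim K W A' B'"
    and "(\<And>y. y \<in> A' \<Longrightarrow> \<exists>x\<in>A. y \<ominus>\<^bsub>W\<^esub> T x \<in> B') \<Longrightarrow> codim K V A B = codim K W A' B'"
proof -
  have TB: "T ` B \<subseteq> B'"
    using T(2) BA by auto
  note I = linear_induced_map_restrict[OF A B BA A' B' BA' T(1) TB]
  interpret Q: linear_map K "quotient_space (V\<lparr>carrier := A\<rparr>) B" "quotient_space (W\<lparr>carrier := A'\<rparr>) B'"
      "induced_map W B' T"
    by (rule I(1))
  have AV: "A \<subseteq> carrier V" "A' \<subseteq> carrier W"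
    using V.subspaceD(1)[OF A] W.subspaceD(1)[OF A'] by auto
  have inj: "inj_on (induced_map W B' T) (carrier (quotient_space (V\<lparr>carrier := A\<rparr>) B))"
  proof (rule inj_onI, simp, elim imageE, simp add: I(2))
    fix x y assume xy: "x \<in> A" "y \<in> A" "B' +>\<^bsub>W\<^esub> T x = B' +>\<^bsub>W\<^esub> T y"
    then have c: "x \<in> carrier V" "y \<in> carrier V" "x \<ominus>\<^bsub>V\<^esub> y \<in> A"
      using AV V.subspaceD(6)[OF A] by auto
    then have "T (x \<ominus>\<^bsub>V\<^esub> y) \<in> B'"
      using xy W.coset_eq_iff[OF B'] f_closed by auto
    then show "B +>\<^bsub>V\<^esub> x = B +>\<^bsub>V\<^esub> y"
      using T(2)[OF c(3)] c V.coset_eq_iff[OF B] by simp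
  qed
  show "codim K V A B \<le> codim K W A' B'" if "fin_codim K W A' B'"
    using Q.dim_le_of_inj[OF _ _ inj] that fin by (simp add: codim_def fin_codim_def)
  show "codim K V A B = codim K W A' B'" if *: "\<And>y. y \<in> A' \<Longrightarrow> \<exists>x\<in>A. y \<ominus>\<^bsub>W\<^esub> T x \<in> B'"
  proof -
    have "B' +>\<^bsub>W\<^esub> y \<in> (\<lambda>x. B' +>\<^bsub>W\<^esub> T x) ` A" if y: "y \<in> A'" for y
    proof -
      obtain x where x: "x \<in> A" "y \<ominus>\<^bsub>W\<^esub> T x \<in> B'" using *[OF y] by blast
      then have "B' +>\<^bsub>W\<^esub> y = B' +>\<^bsub>W\<^esub> T x"
        using W.coset_eq_iff[OF B', of y "T x"] AV y f_closed by blast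
      then show ?thesis using x by blast
    qed
    moreover have "B' +>\<^bsub>W\<^esub> T x \<in> (\<lambda>x. B' +>\<^bsub>W\<^esub> x) ` A'" if "x \<in> A" for x
      using that T(1) by auto
    ultimately have "induced_map W B' T ` carrier (quotient_space (V\<lparr>carrier := A\<rparr>) B) =
        carrier (quotient_space (W\<lparr>carrier := A'\<rparr>) B')"
      by (auto simp: I(2) image_image)
    from Q.dim_eq[OF _ inj this] fin show ?thesis
      by (simp add: codim_def fin_codim_def)
  qed
qed

context vectorspace
begin

text \<open>Rank-nullity for the projection of A/C onto A/B, whose kernel is B/C.\<close>

lemma codim_add:
  assumes A: "VectorSpace.subspace K A V" and B: "VectorSpace.subspace K B V"
    and C: "VectorSpace.subspace K C V" and CB: "C \<subseteq> B" and BA: "B \<subseteq> A"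
    and fin: "fin_codim K V A C"
  shows "fin_codim K V A B" "fin_codim K V B C"
    and "codim K V A C = codim K V A B + codim K V B C"
proof -
  interpret I: linear_map K V V id by (rule linear_map_id)
  have CA: "C \<subseteq> A" using CB BA by blast
  have id: "id ` A \<subseteq> A" "id ` C \<subseteq> B" using CB by auto
  note I = I.linear_induced_map_restrict[OF A C CA A B BA id]
  interpret Q: linear_map K "quotient_space (vs A) C" "quotient_space (vs A) B"
      "induced_map V B id"
    by (rule I(1))
  have AV: "A \<subseteq> carrier V" using subspaceD(1)[OF A] by auto
  have surj: "induced_map V B id ` carrier (quotient_space (vs A) C) =
      carrier (quotient_space (vs A) B)"
    by (simp add: image_image I(2))
  have ker: "Q.kerT = (\<lambda>v. C +>\<^bsub>V\<^esub> v) ` B"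
  proof -
    have "induced_map V B id (C +>\<^bsub>V\<^esub> v) = B \<longleftrightarrow> v \<in> B" if "v \<in> A" for v
      using that AV coset_eq_self_iff[OF B, of v] by (auto simp: I(2))
    then show ?thesis
      using BA by (auto simp: Q.ker_def)
  qed
  have fd: "vectorspace.fin_dim K (quotient_space (vs A) C)"
    using fin by (simp add: fin_codim_def)
  have vsB: "(quotient_space (vs A) C)\<lparr>carrier := Q.kerT\<rparr> = quotient_space (vs B) C"
    unfolding ker by (simp add: quotient_space_carrier_update)
  show "fin_codim K V A B"
    using Q.surj_fin_dim[OF fd surj] by (simp add: fin_codim_def)
  show "fin_codim K V B C"
    using Q.V.fin_dim_subspace(1)[OF fd Q.kerT_is_subspace] vsB by (simp add: fin_codim_def)
  show "codim K V A C = codim K V A B + codim K V B C"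
  proof -
    have "(quotient_space (vs A) B)\<lparr>carrier := Q.imT\<rparr> = quotient_space (vs A) B"
      unfolding Q.im_def surj by simp
    then show ?thesis
      using Q.rank_nullity[OF fd] vsB by (simp add: codim_def)
  qed
qed

end

section \<open>Local entropy\<close>

text \<open>Membership in \<open>U\<close> is a separate conjunct because of n = 0, where the
  bounded condition is vacuous but the cotrajectory is still \<open>U\<close>.\<close>

lemma mem_cotrajectory_iff:
  "x \<in> cotrajectory \<phi> U n \<longleftrightarrow> x \<in> U \<and> (\<forall>i<n. (\<phi> ^^ i) x \<in> U)"
proof -
  have "(\<forall>i\<in>{1..<n}. (\<phi> ^^ i) x \<in> U) \<longleftrightarrow> (\<forall>i<n. (\<phi> ^^ i) x \<in> U)" if "x \<in> U"
  proof -
    have "(\<phi> ^^ i) x \<in> U" if "\<forall>i\<in>{1..<n}. (\<phi> ^^ i) x \<in> U" "i < n" for i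
      using that \<open>x \<in> U\<close> by (cases "i = 0") auto
    then show ?thesis by auto
  qed
  then show ?thesis
    by (auto simp: cotrajectory_def)
qed

lemma cotrajectory_subset: "cotrajectory \<phi> U n \<subseteq> U"
  by (auto simp: cotrajectory_def)

lemma cotrajectory_mono: "U \<subseteq> U' \<Longrightarrow> n' \<le> n \<Longrightarrow> cotrajectory \<phi> U n \<subseteq> cotrajectory \<phi> U' n'"
  by (force simp: mem_cotrajectory_iff)

text \<open>Applying \<phi> shifts the trajectory by one. The index starts at \<open>Suc n\<close>
  because the cotrajectories of lengths 0 and 1 are both \<open>U\<close>, for which the shift
  fails.\<close>

lemma apply_mem_cotrajectory_iff:
  assumes "x \<in> U"
  shows "\<phi> x \<in> cotrajectory \<phi> U (Suc n) \<longleftrightarrow> x \<in> cotrajectory \<phi> U (Suc (Suc n))"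
proof -
  have "(\<forall>i<Suc (Suc n). (\<phi> ^^ i) x \<in> U) \<longleftrightarrow> (\<forall>i<Suc n. (\<phi> ^^ i) (\<phi> x) \<in> U)"
    unfolding All_less_Suc2[of "Suc n"] using assms by (simp add: funpow_swap1)
  then show ?thesis
    using assms by (auto simp: mem_cotrajectory_iff)
qed

lemma cotrajectory_1: "cotrajectory \<phi> U (Suc 0) = U"
  by (auto simp: mem_cotrajectory_iff)

lemma cotrajectory_Int_invariant:
  assumes "\<phi> ` W \<subseteq> W"
  shows "cotrajectory \<phi> (U \<inter> W) n = cotrajectory \<phi> U n \<inter> W"
proof -
  have "(\<phi> ^^ i) x \<in> W" if "x \<in> W" for x i
    using that assms by (induction i) auto
  then show ?thesis
    by (auto simp: mem_cotrajectory_iff)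
qed

text \<open>A trajectory that starts in \<open>W\<close> never leaves it, so the value
  \<open>undefined\<close> that \<open>restrict\<close> takes off \<open>W\<close> is never
  met.\<close>

lemma cotrajectory_restrict:
  assumes "\<phi> ` W \<subseteq> W" "U \<subseteq> W"
  shows "cotrajectory (restrict \<phi> W) U n = cotrajectory \<phi> U n"
proof -
  have "(restrict \<phi> W ^^ i) x = (\<phi> ^^ i) x \<and> (\<phi> ^^ i) x \<in> W" if "x \<in> W" for x i
    using that assms(1) by (induction i) auto
  then show ?thesis
    using assms(2) by (auto simp: mem_cotrajectory_iff)
qed

lemma local_entropy_eq:
  "local_entropy K V \<phi> U =
     lim (\<lambda>n. 1 / real n * real (codim K V U (cotrajectory \<phi> U n)))"
  by (simp add: local_entropy_def codim_def)

lemma local_entropy_restrict: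
  assumes "\<phi> ` W \<subseteq> W" "U \<subseteq> W"
  shows "local_entropy K (V\<lparr>carrier := W\<rparr>) (restrict \<phi> W) U = local_entropy K V \<phi> U"
  by (simp add: local_entropy_eq cotrajectory_restrict[OF assms])

text \<open>From index k on, the quotient is \<open>d\<close> plus a constant multiple of the
  reciprocal of the index.\<close>

lemma tendsto_eventually_linear:
  fixes f :: "nat \<Rightarrow> real"
  assumes "\<And>n. f (n + k) = c + real n * d"
  shows "(\<lambda>n. 1 / real n * f n) \<longlonglongrightarrow> d"
\<comment> \<open>Shifting by \<open>Suc k\<close> instead of \<open>k\<close> keeps every index
  positive, so the division is genuine.\<close>
proof (rule LIMSEQ_offset[where k = "Suc k"])
  have "(\<lambda>n. d + (c + d - real (Suc k) * d) * inverse (real (n + Suc k))) \<longlonglongrightarrow> d + (c + d - real (Suc k) * d) * 0"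
    by (intro tendsto_intros LIMSEQ_ignore_initial_segment lim_inverse_n)
  moreover have "1 / real (n + Suc k) * f (n + Suc k) =
      d + (c + d - real (Suc k) * d) * inverse (real (n + Suc k))" for n
  proof -
    have "f (n + Suc k) = c + real (Suc n) * d"
      using assms[of "Suc n"] by simp
    then show ?thesis
      by (simp add: field_simps)
  qed
  ultimately show "(\<lambda>n. 1 / real (n + Suc k) * f (n + Suc k)) \<longlonglongrightarrow> d"
    by simp
qed

lemma antimono_nat_eventually_const:
  fixes d :: "nat \<Rightarrow> nat"
  assumes "\<And>n. d (Suc n) \<le> d n"
  obtains N where "\<And>n. n \<ge> N \<Longrightarrow> d n = d N"
proof -
  define m where "m = (LEAST m. m \<in> range d)"
  have "m \<in> range d"
    unfolding m_def by (rule LeastI[of _ "d 0"]) auto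
  then obtain N where N: "m = d N" by blast
  have "d n = d N" if "n \<ge> N" for n
  proof (rule antisym)
    show "d n \<le> d N"
      using lift_Suc_antimono_le[of d N n] assms that by auto
    show "d N \<le> d n"
      unfolding N[symmetric] m_def by (rule Least_le) auto
  qed
  then show ?thesis by (rule that)
qed

locale linear_endo = linear_map K V V \<phi> for K V \<phi>
begin

abbreviation "sub U \<equiv> VectorSpace.subspace K U V"

lemma funpow_closed: "x \<in> carrier V \<Longrightarrow> (\<phi> ^^ i) x \<in> carrier V"
  by (induction i) (auto simp: f_closed)

lemma linear_funpow: "linear_map K V V (\<phi> ^^ i)"
proof (induction i)
  case 0
  then show ?case using V.linear_map_id by (simp add: id_def)
next
  case (Suc i)
  then interpret F: linear_map K V V "\<phi> ^^ i" .
  show ?case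
    by (rule linear_mapI) (auto simp: V.vectorspace_axioms f_closed F.f_closed)
qed

lemma sub_cotrajectory:
  assumes U: "sub U"
  shows "sub (cotrajectory \<phi> U n)"
proof -
  have "sub {x \<in> carrier V. (\<phi> ^^ i) x \<in> U}" for i
    by (rule linear_map.subspace_vimage[OF linear_funpow U])
  note S = V.subspaceD[OF this, simplified] and U' = V.subspaceD[OF U]
  show ?thesis
    using S U' by (intro V.subspaceI) (auto simp: mem_cotrajectory_iff subset_iff)
qed

text \<open>\<open>\<phi>\<close> embeds each quotient of consecutive cotrajectories into the preceding one, so their
  dimensions are eventually constant.\<close>

lemma tendsto_local_entropy:
  assumes U: "sub U" and fin: "\<And>n. fin_codim K V U (cotrajectory \<phi> U n)"
  shows "(\<lambda>n. 1 / real n * real (codim K V U (cotrajectory \<phi> U n))) \<longlonglongrightarrow> local_entropy K V \<phi> U"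
proof -
  let ?C = "cotrajectory \<phi> U"
  have C: "sub (?C n)" for n by (rule sub_cotrajectory[OF U])
  have mono: "?C n \<subseteq> ?C m" if "m \<le> n" for m n
    using that by (simp add: cotrajectory_mono)
  have fin': "fin_codim K V (?C m) (?C n)" if "m \<le> n" for m n
    using V.codim_add(2)[OF U C[of m] C[of n] mono[OF that] cotrajectory_subset fin] .
  \<comment> \<open>The first quotient of interest is that of lengths 1 and 2: lengths 0 and 1 give
    the same space, and including them would break monotonicity.\<close>
  define d where "d n = codim K V (?C (Suc n)) (?C (Suc (Suc n)))" for n
  have "d (Suc n) \<le> d n" for n
    unfolding d_def
  proof (rule codim_mono(1))
    show "\<phi> ` ?C (Suc (Suc n)) \<subseteq> ?C (Suc n)"
      using apply_mem_cotrajectory_iff[of _ U] cotrajectory_subset[of \<phi> U] by blast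
    show "\<phi> x \<in> ?C (Suc (Suc n)) \<longleftrightarrow> x \<in> ?C (Suc (Suc (Suc n)))" if "x \<in> ?C (Suc (Suc n))" for x
      using that apply_mem_cotrajectory_iff[of x U] cotrajectory_subset[of \<phi> U] by blast
  qed (auto intro!: C mono fin')
  then obtain N where N: "\<And>n. n \<ge> N \<Longrightarrow> d n = d N"
    using antimono_nat_eventually_const by blast
  have lin: "codim K V U (?C (n + Suc N)) = codim K V U (?C (Suc N)) + n * d N" for n
  proof (induction n)
    case (Suc n)
    have "codim K V U (?C (Suc n + Suc N)) =
        codim K V U (?C (n + Suc N)) + codim K V (?C (n + Suc N)) (?C (Suc n + Suc N))"
      by (rule V.codim_add(3)) (auto intro!: U C mono fin cotrajectory_subset)
    also have "codim K V (?C (n + Suc N)) (?C (Suc n + Suc N)) = d N"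
      using N[of "n + N"] by (simp add: d_def)
    finally show ?case using Suc by simp
  qed simp
  have "(\<lambda>n. 1 / real n * real (codim K V U (?C n))) \<longlonglongrightarrow> real (d N)"
    by (rule tendsto_eventually_linear[where k = "Suc N" and c = "real (codim K V U (?C (Suc N)))"]) (simp only: lin of_nat_add of_nat_mult)
  then show ?thesis
    unfolding local_entropy_eq by (simp add: limI)
qed

lemma local_entropy_nonneg:
  assumes "sub U" "\<And>n. fin_codim K V U (cotrajectory \<phi> U n)"
  shows "0 \<le> local_entropy K V \<phi> U"
  by (rule LIMSEQ_le_const[OF tendsto_local_entropy[OF assms]]) auto

text \<open>The dimension of U/U' does not depend on n, so it disappears after division by n; what
  remains is the inclusion of cotrajectories.\<close>

lemma local_entropy_antimono:
  assumes U: "sub U" and U': "sub U'" and UU': "U' \<subseteq> U"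
    and fin: "\<And>n. fin_codim K V U (cotrajectory \<phi> U' n)"
  shows "local_entropy K V \<phi> U \<le> local_entropy K V \<phi> U'"
proof -
  let ?C = "cotrajectory \<phi> U" and ?C' = "cotrajectory \<phi> U'"
  note C = sub_cotrajectory[OF U] and C' = sub_cotrajectory[OF U']
  have sub: "?C' n \<subseteq> ?C n" for n
    by (rule cotrajectory_mono[OF UU' order_refl])
  note add = V.codim_add[OF U C C' sub cotrajectory_subset fin]
  note add' = V.codim_add[OF U U' C' cotrajectory_subset UU' fin]
  have "(\<lambda>n. 1 / real n * real (codim K V U U') + 1 / real n * real (codim K V U' (?C' n)))
      \<longlonglongrightarrow> 0 * real (codim K V U U') + local_entropy K V \<phi> U'"
    by (intro tendsto_intros lim_1_over_n tendsto_local_entropy U' add'(2))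
  then have "(\<lambda>n. 1 / real n * real (codim K V U U') + 1 / real n * real (codim K V U' (?C' n)))
      \<longlonglongrightarrow> local_entropy K V \<phi> U'"
    by simp
  moreover have "1 / real n * real (codim K V U (?C n)) \<le>
      1 / real n * real (codim K V U U') + 1 / real n * real (codim K V U' (?C' n))" for n
  proof -
    have "codim K V U (?C n) \<le> codim K V U U' + codim K V U' (?C' n)"
      using add(3)[of n] add'(3)[of n] by linarith
    then have "real (codim K V U (?C n)) \<le> real (codim K V U U') + real (codim K V U' (?C' n))"
      by linarith
    then show ?thesis
      unfolding distrib_left[symmetric] by (rule mult_left_mono) simp
  qed
  ultimately show ?thesis
    using tendsto_local_entropy[OF U add(1)] LIMSEQ_le by blast
qed

end

section \<open>An invariant subspace and the induced map on the quotient\<close>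

locale invariant_subspace = linear_endo +
  fixes W
  assumes W: "VectorSpace.subspace K W V" and invariant: "\<phi> ` W \<subseteq> W"
begin

abbreviation "VW \<equiv> quotient_space V W"
abbreviation "p \<equiv> (\<lambda>v. W +>\<^bsub>V\<^esub> v)"
abbreviation "\<psi> \<equiv> quotient_endomorphism V W \<phi>"

sublocale p: linear_map K V VW p
  by (rule V.linear_coset_map[OF W])

lemma linear_quotient_endomorphism: "linear_endo K VW \<psi>"
  unfolding quotient_endomorphism_eq linear_endo_def
  by (rule linear_induced_map[OF W W invariant])

sublocale \<psi>: linear_endo K VW \<psi>
  by (rule linear_quotient_endomorphism)

lemma \<psi>_p: "x \<in> carrier V \<Longrightarrow> \<psi> (p x) = p (\<phi> x)"
  unfolding quotient_endomorphism_eq by (rule induced_map_coset[OF W W invariant])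

lemma funpow_\<psi>_p: "x \<in> carrier V \<Longrightarrow> (\<psi> ^^ i) (p x) = p ((\<phi> ^^ i) x)"
  by (induction i) (auto simp: \<psi>_p funpow_closed)

lemma p_mem_image_iff:
  assumes "sub U" "x \<in> carrier V"
  shows "p x \<in> p ` U \<longleftrightarrow> (\<exists>u\<in>U. x \<ominus>\<^bsub>V\<^esub> u \<in> W)"
proof -
  have "p x = p u \<longleftrightarrow> x \<ominus>\<^bsub>V\<^esub> u \<in> W" if "u \<in> U" for u
    using that assms V.subspaceD(1)[OF assms(1)] by (intro V.coset_eq_iff[OF W]) auto
  then show ?thesis by auto
qed

lemma p_mem_cotrajectory_iff:
  "x \<in> carrier V \<Longrightarrow> p x \<in> cotrajectory \<psi> Y n \<longleftrightarrow> p x \<in> Y \<and> (\<forall>i<n. p ((\<phi> ^^ i) x) \<in> Y)"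
  by (simp add: mem_cotrajectory_iff funpow_\<psi>_p)

text \<open>For each n a subspace \<open>Y\<close> is placed between the cotrajectory and
  \<open>U\<close>, so that U/Y accounts for the quotient and Y/C for at least the part in
  \<open>W\<close>.\<close>

lemma local_entropy_add_le:
  assumes U: "sub U"
    and fin: "\<And>n. fin_codim K V U (cotrajectory \<phi> U n)"
    and fin': "\<And>n. fin_codim K VW (p ` U) (cotrajectory \<psi> (p ` U) n)"
    and fin'': "\<And>n. fin_codim K V (U \<inter> W) (cotrajectory \<phi> (U \<inter> W) n)"
  shows "local_entropy K V \<phi> (U \<inter> W) + local_entropy K VW \<psi> (p ` U) \<le> local_entropy K V \<phi> U"
proof -
  let ?C = "cotrajectory \<phi> U" and ?D = "cotrajectory \<psi> (p ` U)" and ?E = "cotrajectory \<phi> (U \<inter> W)"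
  have UW: "sub (U \<inter> W)" by (rule V.subspace_Int[OF U W])
  have UV: "U \<subseteq> carrier V" by (rule V.subspaceD(1)[OF U])
  have le: "codim K V (U \<inter> W) (?E n) + codim K VW (p ` U) (?D n) \<le> codim K V U (?C n)" for n
  proof -
    \<comment> \<open>\<open>Y\<close> consists of the points of \<open>U\<close> whose trajectory
      stays in \<open>U\<close> modulo \<open>W\<close>. It contains U \<inter> W, because elements
      of \<open>W\<close> have class zero.\<close>
    define Y where "Y = U \<inter> {x \<in> carrier V. p x \<in> ?D n}"
    have D: "\<psi>.sub (?D n)" by (rule \<psi>.sub_cotrajectory[OF p.subspace_image[OF U]])
    have Y: "sub Y"
      unfolding Y_def by (intro V.subspace_Int U p.subspace_vimage[OF D])
    have C: "sub (?C n)" and E: "sub (?E n)"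
      using sub_cotrajectory U UW by auto
    have CY: "?C n \<subseteq> Y"
      using UV by (auto simp: Y_def p_mem_cotrajectory_iff mem_cotrajectory_iff[of _ \<phi>]
          simp del: quotient_space_simps)
    have YU: "Y \<subseteq> U" by (auto simp: Y_def)
    note add = V.codim_add[OF U Y C CY YU fin]
    have 1: "codim K V U Y = codim K VW (p ` U) (?D n)"
    proof (rule p.codim_mono(2)[OF U Y YU p.subspace_image[OF U] D cotrajectory_subset])
      show "fin_codim K V U Y" by (rule add(1))
      fix y assume "y \<in> p ` U"
      then obtain x where "x \<in> U" "y = p x" by blast
      then have "y \<ominus>\<^bsub>VW\<^esub> p x = \<zero>\<^bsub>VW\<^esub>"
        using UV p.W.diff_self[of "p x"] by auto
      then show "\<exists>x\<in>U. y \<ominus>\<^bsub>VW\<^esub> p x \<in> ?D n"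
        using \<open>x \<in> U\<close> p.W.subspaceD(2)[OF D] by metis
    qed (use UV in \<open>auto simp: Y_def\<close>)
    have WY: "U \<inter> W \<subseteq> Y"
    proof -
      have "p x \<in> ?D n" if "x \<in> W" "x \<in> U" for x
      proof -
        have "p x = \<zero>\<^bsub>VW\<^esub>"
          using that UV V.coset_eq_self_iff[OF W] by auto
        then show ?thesis
          using p.W.subspaceD(2)[OF D] by metis
      qed
      then show ?thesis
        using UV by (auto simp: Y_def)
    qed
    have E_eq: "?E n = ?C n \<inter> W"
      by (rule cotrajectory_Int_invariant[OF invariant])
    interpret I: linear_map K V V id by (rule V.linear_map_id)
    \<comment> \<open>The inclusion of U \<inter> W in \<open>Y\<close> is injective on quotients
      because \<open>?E n\<close> is \<open>?C n\<close> cut with \<open>W\<close>. It need not be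
      onto, and this is where equality may be lost.\<close>
    have YW: "codim K V (U \<inter> W) (?E n) \<le> codim K V Y (?C n)"
      by (rule I.codim_mono(1)[OF UW E cotrajectory_subset Y C CY _ _ fin'' add(2)])
        (use WY E_eq in auto)
    show "codim K V (U \<inter> W) (?E n) + codim K VW (p ` U) (?D n) \<le> codim K V U (?C n)"
      using YW 1 add(3) by simp
  qed
  have lim: "(\<lambda>n. 1 / real n * real (codim K V (U \<inter> W) (?E n)) + 1 / real n * real (codim K VW (p ` U) (?D n)))
      \<longlonglongrightarrow> local_entropy K V \<phi> (U \<inter> W) + local_entropy K VW \<psi> (p ` U)"
    by (intro tendsto_add tendsto_local_entropy \<psi>.tendsto_local_entropy UW p.subspace_image U fin'' fin')
  show ?thesis
  proof (rule LIMSEQ_le[OF lim tendsto_local_entropy[OF U fin]], intro exI allI impI)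
    fix n
    have "real (codim K V (U \<inter> W) (?E n)) + real (codim K VW (p ` U) (?D n)) \<le> real (codim K V U (?C n))"
      using le[of n] by linarith
    then show "1 / real n * real (codim K V (U \<inter> W) (?E n)) + 1 / real n * real (codim K VW (p ` U) (?D n))
        \<le> 1 / real n * real (codim K V U (?C n))"
      unfolding distrib_left[symmetric] by (rule mult_left_mono) simp
  qed
qed

end

section \<open>Bowen's inequality\<close>

text \<open>Gluing of blocks: the hypothesis covers times 0 to k, the block starting at time k
  covers k to k + m, and the two overlap in time k.\<close>

lemma funpow_mem_cotrajectory_iff:
  assumes "x \<in> cotrajectory \<phi> U (Suc k)"
  shows "(\<phi> ^^ k) x \<in> cotrajectory \<phi> U (Suc m) \<longleftrightarrow> x \<in> cotrajectory \<phi> U (Suc (k + m))"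
proof
  assume *: "(\<phi> ^^ k) x \<in> cotrajectory \<phi> U (Suc m)"
  have "(\<phi> ^^ i) x \<in> U" if "i < Suc (k + m)" for i
  proof (cases "i < Suc k")
    case True
    then show ?thesis using assms by (auto simp: mem_cotrajectory_iff)
  next
    case False
    then have "(\<phi> ^^ (i - k)) ((\<phi> ^^ k) x) \<in> U"
      using * that by (auto simp: mem_cotrajectory_iff)
    moreover have "(\<phi> ^^ (i - k)) ((\<phi> ^^ k) x) = (\<phi> ^^ i) x"
      using False funpow_add[of "i - k" k \<phi>] by (simp add: fun_eq_iff)
    ultimately show ?thesis by simp
  qed
  then show "x \<in> cotrajectory \<phi> U (Suc (k + m))"
    using assms by (auto simp: mem_cotrajectory_iff)
next
  assume "x \<in> cotrajectory \<phi> U (Suc (k + m))"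
  then have *: "(\<phi> ^^ i) x \<in> U" if "i < Suc (k + m)" for i
    using that by (auto simp: mem_cotrajectory_iff)
  have "(\<phi> ^^ i) ((\<phi> ^^ k) x) \<in> U" if "i < Suc m" for i
    using *[of "i + k"] that by (simp add: funpow_add)
  then show "(\<phi> ^^ k) x \<in> cotrajectory \<phi> U (Suc m)"
    using *[of k] by (auto simp: mem_cotrajectory_iff)
qed

context invariant_subspace
begin

text \<open>The chain \<open>U\<close>, \<open>A\<close>, \<open>X\<close> = \<open>Xs 0\<close>,
  ..., \<open>Xs n\<close> ends inside the cotrajectory. The step from \<open>U\<close> to
  \<open>A\<close> costs a constant, that from \<open>A\<close> to \<open>X\<close> embeds in the
  quotient by \<open>D\<close>, and each of the n block steps costs at most
  \<open>a\<close>.\<close>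

lemma codim_cotrajectory_le:
  assumes U: "sub U" and U': "sub U'" and UU': "U' \<subseteq> cotrajectory \<phi> U (Suc m)"
    and fin: "\<And>n. fin_codim K V U (cotrajectory \<phi> U' n)"
    and fin_quot: "\<And>n. fin_codim K VW (p ` U') (cotrajectory \<psi> (p ` U') n)"
    and fin_W: "\<And>n. fin_codim K V (U \<inter> W) (cotrajectory \<phi> (U \<inter> W) n)"
  shows "codim K V U (cotrajectory \<phi> U (Suc (n * m))) \<le>
    codim K V U {x \<in> U. p x \<in> p ` U'} + codim K VW (p ` U') (cotrajectory \<psi> (p ` U') (Suc (n * m))) +
    n * codim K V (U \<inter> W) (cotrajectory \<phi> (U \<inter> W) (Suc m))"
proof -
  define N where "N = Suc (n * m)"
  define a where "a = codim K V (U \<inter> W) (cotrajectory \<phi> (U \<inter> W) (Suc m))"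
  define A where "A = {x \<in> U. p x \<in> p ` U'}"
  define D where "D = cotrajectory \<psi> (p ` U') N"
  define X where "X = {x \<in> U. p x \<in> D}"
  define Xs where "Xs j = X \<inter> cotrajectory \<phi> U (Suc (j * m))" for j
  \<comment> \<open>\<open>Z\<close> lies below every subspace compared here and has finite
    codimension in \<open>U\<close>, so all intermediate quotients are finite-dimensional; this is
    \<open>fin_between\<close>.\<close>
  define Z where "Z = cotrajectory \<phi> U' N"
  define B where "B = cotrajectory \<phi> U (Suc m)"
  \<comment> \<open>This is U \<inter> (B + W), which by the modular law equals B + (U \<inter> W),
    since B \<subseteq> U.\<close>
  define A' where "A' = {x \<in> U. p x \<in> p ` B}"
  have UV: "U \<subseteq> carrier V" by (rule V.subspaceD(1)[OF U])
  have U'B: "U' \<subseteq> B" using UU' by (simp add: B_def)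
  have BU: "B \<subseteq> U" by (simp add: B_def cotrajectory_subset)
  have sub_pre: "sub {x \<in> U. p x \<in> Y}" if "\<psi>.sub Y" for Y
  proof -
    have "{x \<in> U. p x \<in> Y} = U \<inter> {x \<in> carrier V. p x \<in> Y}" using UV by auto
    then show ?thesis
      using V.subspace_Int[OF U p.subspace_vimage[OF that]] by simp
  qed
  have D: "\<psi>.sub D"
    unfolding D_def by (rule \<psi>.sub_cotrajectory[OF p.subspace_image[OF U']])
  have B: "sub B"
    unfolding B_def by (rule sub_cotrajectory[OF U])
  have A: "sub A" and X: "sub X" and A': "sub A'"
    unfolding A_def X_def A'_def using sub_pre p.subspace_image U' D B by auto
  have Xs: "sub (Xs j)" for j
    unfolding Xs_def by (rule V.subspace_Int[OF X sub_cotrajectory[OF U]])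
  have Z: "sub Z" unfolding Z_def by (rule sub_cotrajectory[OF U'])
  have fin_between: "fin_codim K V P Q" if "sub P" "sub Q" "Z \<subseteq> Q" "Q \<subseteq> P" "P \<subseteq> U" for P Q
  proof -
    have "fin_codim K V P Z"
      using V.codim_add(2)[OF U that(1) Z _ that(5)] that fin by (auto simp: Z_def)
    then show ?thesis
      by (rule V.codim_add(1)[OF that(1,2) Z that(3,4)])
  qed
  have ZU': "Z \<subseteq> U'" by (simp add: Z_def cotrajectory_subset)
  have ZX: "Z \<subseteq> X"
  proof
    fix x assume x: "x \<in> Z"
    then have "x \<in> U" "x \<in> carrier V" using ZU' U'B BU UV by auto
    then show "x \<in> X"
      using x by (auto simp: X_def D_def Z_def p_mem_cotrajectory_iff mem_cotrajectory_iff[of _ \<phi>]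
          simp del: quotient_space_simps)
  qed
  have ZXs: "Z \<subseteq> Xs j" if "j \<le> n" for j
  proof -
    have "Z \<subseteq> cotrajectory \<phi> U (Suc (j * m))"
      unfolding Z_def using that U'B BU by (intro cotrajectory_mono) (auto simp: N_def)
    then show ?thesis using ZX by (auto simp: Xs_def)
  qed
  have XU: "X \<subseteq> U" and AU: "A \<subseteq> U" and A'U: "A' \<subseteq> U"
    by (auto simp: X_def A_def A'_def)
  have XA: "X \<subseteq> A"
    using cotrajectory_subset by (force simp: X_def A_def D_def)
  have BA': "B \<subseteq> A'" using BU by (auto simp: A'_def)
  have XsX: "Xs j \<subseteq> X" for j by (simp add: Xs_def)
  have mem_A': "x \<in> A' \<longleftrightarrow> x \<in> U \<and> (\<exists>u\<in>B. x \<ominus>\<^bsub>V\<^esub> u \<in> W)" for x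
    using p_mem_image_iff[OF B, of x] UV by (auto simp: A'_def simp del: quotient_space_simps)
  have fin_A': "fin_codim K V A' B"
    using fin_between A' B BA' A'U ZU' U'B by auto
  \<comment> \<open>Second isomorphism theorem: (B + (U \<inter> W))/B against (U \<inter> W)/(B
    \<inter> W), where B \<inter> W is the cotrajectory of U \<inter> W.\<close>
  have "a = codim K V A' B"
  proof -
    interpret I: linear_map K V V id by (rule V.linear_map_id)
    have E: "sub (cotrajectory \<phi> (U \<inter> W) (Suc m))"
      using sub_cotrajectory V.subspace_Int[OF U W] by auto
    show ?thesis
      unfolding a_def
    proof (rule I.codim_mono(2)[OF V.subspace_Int[OF U W] E cotrajectory_subset A' B BA' _ _ fin_W])
      show "id ` (U \<inter> W) \<subseteq> A'"
      proof
        fix x assume "x \<in> id ` (U \<inter> W)"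
        then have "x \<in> U" "x \<ominus>\<^bsub>V\<^esub> \<zero>\<^bsub>V\<^esub> \<in> W" using UV V.diff_zero[of x] by auto
        then show "x \<in> A'" using V.subspaceD(2)[OF B] unfolding mem_A' by blast
      qed
      show "id x \<in> B \<longleftrightarrow> x \<in> cotrajectory \<phi> (U \<inter> W) (Suc m)" if "x \<in> U \<inter> W" for x
        using that by (simp add: B_def cotrajectory_Int_invariant[OF invariant])
      show "\<exists>x\<in>U \<inter> W. y \<ominus>\<^bsub>V\<^esub> id x \<in> B" if y: "y \<in> A'" for y
      proof -
        obtain u where u: "u \<in> B" "y \<ominus>\<^bsub>V\<^esub> u \<in> W" "y \<in> U"
          using y unfolding mem_A' by blast
        have c: "y \<in> carrier V" "u \<in> carrier V" using u UV BU by auto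
        \<comment> \<open>The representative of y in U \<inter> W is y - u; it leaves the remainder
          u in \<open>B\<close>.\<close>
        have "y \<ominus>\<^bsub>V\<^esub> (y \<ominus>\<^bsub>V\<^esub> u) = u"
          using c by (rule V.diff_diff_cancel)
        moreover have "y \<ominus>\<^bsub>V\<^esub> u \<in> U"
          using u BU V.subspaceD(6)[OF U] by auto
        ultimately show ?thesis
          using u by (intro bexI[of _ "y \<ominus>\<^bsub>V\<^esub> u"]) auto
      qed
    qed
  qed
  \<comment> \<open>The iterate at the start of the block embeds \<open>Xs j\<close> modulo
    \<open>Xs (Suc j)\<close> into A'/B.\<close>
  have step: "codim K V (Xs j) (Xs (Suc j)) \<le> a" if j: "j < n" for j
  proof -
    interpret F: linear_map K V V "\<phi> ^^ (j * m)" by (rule linear_funpow)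
    have jm: "j * m < N"
      using j by (simp add: N_def less_Suc_eq_le)
    have sub: "Xs (Suc j) \<subseteq> Xs j"
      using cotrajectory_mono[of U U "Suc (j * m)" "Suc (Suc j * m)" \<phi>] by (auto simp: Xs_def)
    show ?thesis
      unfolding \<open>a = codim K V A' B\<close>
    proof (rule F.codim_mono(1)[OF Xs Xs sub A' B BA' _ _ _ fin_A'])
      show "(\<phi> ^^ (j * m)) ` Xs j \<subseteq> A'"
      proof
        fix y assume "y \<in> (\<phi> ^^ (j * m)) ` Xs j"
        then obtain x where x: "x \<in> Xs j" "y = (\<phi> ^^ (j * m)) x" by blast
        then have "y \<in> U" by (auto simp: Xs_def mem_cotrajectory_iff)
        \<comment> \<open>Membership in \<open>X\<close> controls the class of the trajectory at
          every time below \<open>N\<close>, in particular at time \<open>j * m\<close>, and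
          \<open>U'\<close> lies in \<open>B\<close>.\<close>
        moreover have "p y \<in> p ` U'"
          using x jm UV XU by (auto simp: Xs_def X_def D_def p_mem_cotrajectory_iff simp del: quotient_space_simps)
        ultimately show "y \<in> A'"
          using U'B by (auto simp: A'_def)
      qed
      show "(\<phi> ^^ (j * m)) x \<in> B \<longleftrightarrow> x \<in> Xs (Suc j)" if "x \<in> Xs j" for x
        using that funpow_mem_cotrajectory_iff[of x \<phi> U "j * m" m]
        by (auto simp: Xs_def B_def add.commute)
      show "fin_codim K V (Xs j) (Xs (Suc j))"
        using j by (intro fin_between Xs sub ZXs) (use XsX XU in auto)
    qed
  qed
  have Xs_le: "codim K V X (Xs j) \<le> j * a" if "j \<le> n" for j
    using that
  proof (induction j)
    case 0
    have "Xs 0 = X" using XU by (auto simp: Xs_def cotrajectory_1)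
    moreover have "codim K V X X = 0"
      using V.codim_add(3)[OF X X X order_refl order_refl] fin_between[OF X X ZX order_refl XU] by simp
    ultimately show ?case by simp
  next
    case (Suc j)
    have sub: "Xs (Suc j) \<subseteq> Xs j"
      using cotrajectory_mono[of U U "Suc (j * m)" "Suc (Suc j * m)" \<phi>] by (auto simp: Xs_def)
    have "codim K V X (Xs (Suc j)) = codim K V X (Xs j) + codim K V (Xs j) (Xs (Suc j))"
      using Suc by (intro V.codim_add(3) X Xs sub XsX fin_between ZXs XU) auto
    then show ?case
      using Suc step[of j] by simp
  qed
  have XsN: "Xs n \<subseteq> cotrajectory \<phi> U N" by (simp add: Xs_def N_def)
  have "codim K V U (cotrajectory \<phi> U N) \<le> codim K V U (Xs n)"
    using V.codim_add(3)[OF U sub_cotrajectory[OF U] Xs XsN cotrajectory_subset]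
      fin_between[OF U Xs ZXs] XsX XU by fastforce
  also have "\<dots> = codim K V U X + codim K V X (Xs n)"
    by (intro V.codim_add(3) U X Xs XsX XU fin_between ZXs) (use XsX XU in auto)
  also have "codim K V U X = codim K V U A + codim K V A X"
    by (intro V.codim_add(3) U X A XA AU fin_between ZX XU order_refl)
  also have "codim K V A X \<le> codim K VW (p ` U') D"
  proof (rule p.codim_mono(1)[OF A X XA p.subspace_image[OF U'] D])
    show "D \<subseteq> p ` U'" by (simp add: D_def cotrajectory_subset)
    show "fin_codim K V A X" by (intro fin_between A X ZX XA AU)
    show "fin_codim K VW (p ` U') D" using fin_quot by (simp add: D_def)
  qed (auto simp: A_def X_def)
  finally show ?thesis
    using Xs_le[of n] by (simp add: A_def D_def N_def a_def)
qed

text \<open>The preceding count is divided by the length n m + 1: the constant term vanishes, the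
  quotient term tends to its entropy, and the n block costs leave at most \<open>a\<close> /
  m.\<close>

lemma local_entropy_le_block:
  assumes U: "sub U" and U': "sub U'" and UU': "U' \<subseteq> cotrajectory \<phi> U (Suc m)" and m: "m > 0"
    and fin: "\<And>n. fin_codim K V U (cotrajectory \<phi> U' n)"
    and fin_quot: "\<And>n. fin_codim K VW (p ` U') (cotrajectory \<psi> (p ` U') n)"
    and fin_W: "\<And>n. fin_codim K V (U \<inter> W) (cotrajectory \<phi> (U \<inter> W) n)"
  shows "local_entropy K V \<phi> U \<le> local_entropy K VW \<psi> (p ` U') +
    real (codim K V (U \<inter> W) (cotrajectory \<phi> (U \<inter> W) (Suc m))) / m"
proof -
  define a where "a = codim K V (U \<inter> W) (cotrajectory \<phi> (U \<inter> W) (Suc m))"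
  define b where "b = codim K V U {x \<in> U. p x \<in> p ` U'}"
  define c where "c n = codim K V U (cotrajectory \<phi> U n)" for n
  define d where "d n = codim K VW (p ` U') (cotrajectory \<psi> (p ` U') n)" for n
  \<comment> \<open>The count is available only at lengths n m + 1; since both entropies are limits,
    this subsequence suffices.\<close>
  define r where "r n = Suc (n * m)" for n
  have r: "strict_mono r"
    using m by (auto simp: strict_mono_def r_def)
  have fin': "fin_codim K V U (cotrajectory \<phi> U n)" for n
  proof -
    have "cotrajectory \<phi> U' n \<subseteq> cotrajectory \<phi> U n"
      by (intro cotrajectory_mono order_refl subset_trans[OF UU' cotrajectory_subset])
    then show ?thesis
      by (rule V.codim_add(1)[OF U sub_cotrajectory[OF U] sub_cotrajectory[OF U'] _ cotrajectory_subset fin])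
  qed
  have lim_c: "(\<lambda>n. 1 / real (r n) * real (c (r n))) \<longlonglongrightarrow> local_entropy K V \<phi> U"
    using LIMSEQ_subseq_LIMSEQ[OF tendsto_local_entropy[OF U fin'] r] by (simp add: o_def c_def)
  have lim_d: "(\<lambda>n. 1 / real (r n) * real (d (r n))) \<longlonglongrightarrow> local_entropy K VW \<psi> (p ` U')"
    using LIMSEQ_subseq_LIMSEQ[OF \<psi>.tendsto_local_entropy[OF p.subspace_image[OF U'] fin_quot] r]
    by (simp add: o_def d_def)
  have lim_b: "(\<lambda>n. 1 / real (r n)) \<longlonglongrightarrow> 0"
    using LIMSEQ_subseq_LIMSEQ[OF lim_1_over_n r] by (simp add: o_def)
  have lim: "(\<lambda>n. 1 / real (r n) * real b + 1 / real (r n) * real (d (r n)) + real a / real m) \<longlonglongrightarrow>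
      0 * real b + local_entropy K VW \<psi> (p ` U') + real a / m"
    by (intro tendsto_intros lim_b lim_d)
  have "1 / real (r n) * real (c (r n)) \<le>
      1 / real (r n) * real b + 1 / real (r n) * real (d (r n)) + real a / real m" for n
  proof -
    have pos: "real (r n) > 0" unfolding r_def by (simp only: of_nat_0_less_iff)
    have "c (r n) \<le> b + d (r n) + n * a"
      using codim_cotrajectory_le[OF U U' UU' fin fin_quot fin_W, of n]
      by (simp add: a_def b_def c_def d_def r_def)
    then have "real (c (r n)) \<le> real b + real (d (r n)) + real n * real a"
      by (metis of_nat_add of_nat_le_iff of_nat_mult)
    moreover have "real n * real a \<le> real (r n) * (real a / real m)"
      using m by (simp add: r_def field_simps)
    ultimately have "real (c (r n)) \<le> real b + real (d (r n)) + real (r n) * (real a / real m)"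
      by linarith
    then show ?thesis
      using pos by (simp add: pos_divide_le_eq distrib_right mult.commute[of "real a"])
  qed
  then show ?thesis
    using LIMSEQ_le[OF lim_c lim] by (simp add: a_def)
qed

text \<open>\<open>e\<close> bounds the quotient entropies of all the chosen \<open>U'\<close> at
  once. As \<open>U'\<close> may depend on m, only such a uniform bound survives the limit.\<close>

lemma local_entropy_le_add:
  assumes U: "sub U" 
    and fin_W: "\<And>n. fin_codim K V (U \<inter> W) (cotrajectory \<phi> (U \<inter> W) n)"
    and U': "\<And>m. \<exists>U'. sub U' \<and> U' \<subseteq> cotrajectory \<phi> U m \<and>
      (\<forall>n. fin_codim K V U (cotrajectory \<phi> U' n)) \<and>
      (\<forall>n. fin_codim K VW (p ` U') (cotrajectory \<psi> (p ` U') n)) \<and>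
      local_entropy K VW \<psi> (p ` U') \<le> e"
  shows "local_entropy K V \<phi> U \<le> local_entropy K V \<phi> (U \<inter> W) + e"
proof -
  define a where "a n = real (codim K V (U \<inter> W) (cotrajectory \<phi> (U \<inter> W) n))" for n
  have "(\<lambda>n. 1 / real n * a n) \<longlonglongrightarrow> local_entropy K V \<phi> (U \<inter> W)"
    unfolding a_def by (intro tendsto_local_entropy V.subspace_Int U W fin_W)
  \<comment> \<open>The factor 1 + 1/(n+1) equals (n+2)/(n+1); it turns division by the cotrajectory
    length n + 2 into division by the block length n + 1.\<close>
  then have "(\<lambda>n. (1 / real (Suc (Suc n)) * a (Suc (Suc n))) * (1 + 1 / real (Suc n))) \<longlonglongrightarrow>
      local_entropy K V \<phi> (U \<inter> W) * (1 + 0)"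
    by (intro tendsto_intros LIMSEQ_Suc lim_1_over_n) 
  moreover have "1 / real (Suc (Suc n)) * a (Suc (Suc n)) * (1 + 1 / real (Suc n)) =
      a (Suc (Suc n)) / real (Suc n)" for n
  proof -
    have "1 / (s + 1) * b * (1 + 1 / s) = b / s" if "s > 0" for s b :: real
      using that by (simp add: divide_simps)
    from this[of "real (Suc n)"] show ?thesis by (simp add: add.commute)
  qed
  ultimately have "(\<lambda>n. e + a (Suc (Suc n)) / real (Suc n)) \<longlonglongrightarrow> e + local_entropy K V \<phi> (U \<inter> W)"
    by (intro tendsto_intros) simp
  moreover have "local_entropy K V \<phi> U \<le> e + a (Suc (Suc n)) / real (Suc n)" for n
    using U'[of "Suc (Suc n)"] local_entropy_le_block[OF U, of _ "Suc n"] fin_W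
    unfolding a_def by (meson add_right_mono order_trans zero_less_Suc)
  ultimately show ?thesis
    by (metis (no_types, lifting) LIMSEQ_le_const add.commute)
qed

end

section \<open>Linear compactness\<close>

context vectorspace
begin

lemma vimage_coset:
  assumes f: "linear_map K V V' f" and L: "VectorSpace.subspace K L V'" and v: "v \<in> carrier V"
  shows "{x \<in> carrier V. f x \<in> L +>\<^bsub>V'\<^esub> f v} = {x \<in> carrier V. f x \<in> L} +>\<^bsub>V\<^esub> v"
proof -
  interpret f: linear_map K V V' f by fact
  note sub = f.subspace_vimage[OF L]
  show ?thesis
    using v by (auto simp: mem_coset_iff[OF sub] f.W.mem_coset_iff[OF L] f.f_closed)
qed

lemma span_insert_cases:
  assumes "A \<subseteq> carrier V" "v \<in> carrier V" "y \<in> span (insert v A)"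
  obtains a u where "a \<in> carrier K" "u \<in> span A" "y = a \<odot>\<^bsub>V\<^esub> v \<oplus>\<^bsub>V\<^esub> u"
proof -
  have "y \<in> subspace_sum (span {v}) (span A)"
    using assms span_union_is_sum[of "{v}" A] by simp
  then obtain z u where z: "z \<in> span {v}" "u \<in> span A" "y = z \<oplus>\<^bsub>V\<^esub> u"
    by (auto simp: submodule_sum_def)
  obtain a where "a \<in> carrier K" "z = a \<odot>\<^bsub>V\<^esub> v"
  proof -
    obtain b B where b: "finite B" "B \<subseteq> {v}" "b \<in> B \<rightarrow> carrier K" "z = lincomb b B"
      using z(1) by (auto simp: span_def)
    show thesis
    proof (cases "B = {}")
      case True
      then show ?thesis
        using b that[of "\<zero>\<^bsub>K\<^esub>"] assms by (simp add: lincomb_def)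
    next
      case False
      then have "B = {v}" using b by auto
      then show ?thesis
        using b that[of "b v"] assms by (auto simp: lincomb_def)
    qed
  qed
  then show ?thesis using that z by blast
qed

text \<open>Failure of linear compactness for discrete spaces of infinite dimension: with \<open>x\<^sub>0, x\<^sub>1, \<dots>\<close>
  independent, an element common to all cosets \<open>x\<^sub>0 + \<dots> + x\<^sub>n\<^sub>-\<^sub>1 + span {x\<^sub>n, x\<^sub>n\<^sub>+\<^sub>1, \<dots>}\<close> would be
  the infinite sum of the \<open>x\<^sub>i\<close>.\<close>

lemma infinite_dim_nested_cosets:
  assumes "\<not> fin_dim"
  obtains v L where "\<And>n::nat. v n \<in> carrier V" "\<And>n. VectorSpace.subspace K (L n) V"
    "\<And>n. L (Suc n) +>\<^bsub>V\<^esub> v (Suc n) \<subseteq> L n +>\<^bsub>V\<^esub> v n" "(\<Inter>n. L n +>\<^bsub>V\<^esub> v n) = {}"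
proof -
  \<comment> \<open>A finite set never spans, so a vector outside the span of its predecessors can
    be chosen at every stage.\<close>
  have "\<exists>x. \<forall>n::nat. x n \<in> carrier V \<and> x n \<notin> span (x ` {..<n})"
  proof (rule dependent_wellorder_choice[where P = "\<lambda>x n r. r \<in> carrier V \<and> r \<notin> span (x ` {..<n})"])
    fix n :: nat and x :: "nat \<Rightarrow> 'c"
    assume "\<And>m. m < n \<Longrightarrow> x m \<in> carrier V \<and> x m \<notin> span (x ` {..<m})"
    then have c: "x ` {..<n} \<subseteq> carrier V" by auto
    then have "span (x ` {..<n}) \<noteq> carrier V"
      using assms by (auto simp: fin_dim_def)
    then show "\<exists>r. r \<in> carrier V \<and> r \<notin> span (x ` {..<n})"
      using span_is_subset2[OF c] by blast
  next
    fix r and x y :: "nat \<Rightarrow> 'c" and n :: nat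
    assume "\<And>m. m < n \<Longrightarrow> x m = y m"
    then have "x ` {..<n} = y ` {..<n}" by (intro image_cong) auto
    then show "(r \<in> carrier V \<and> r \<notin> span (x ` {..<n})) = (r \<in> carrier V \<and> r \<notin> span (y ` {..<n}))"
      by simp
  qed
  then obtain x where *: "\<forall>n::nat. x n \<in> carrier V \<and> x n \<notin> span (x ` {..<n})" ..
  have x: "x n \<in> carrier V" "x n \<notin> span (x ` {..<n})" for n
    using *[rule_format, of n] by auto
  define S where "S n = span (x ` {..<n})" for n
  define L where "L n = span (x ` {n..})" for n
  have xA: "x ` A \<subseteq> carrier V" for A using x by auto
  have S: "VectorSpace.subspace K (S n) V" and L: "VectorSpace.subspace K (L n) V" for n
    unfolding S_def L_def using xA by (auto intro!: span_is_subspace)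
  have x_span: "x i \<in> span (x ` A)" if "i \<in> A" for i A
    using in_own_span[OF xA, of A] that by auto
  have L_finite: "\<exists>m. y \<in> span (x ` {n..<m})" if "y \<in> L n" for y n
  proof -
    obtain b B where b: "finite B" "B \<subseteq> x ` {n..}" "b \<in> B \<rightarrow> carrier K" "y = lincomb b B"
      using \<open>y \<in> L n\<close> by (auto simp: L_def span_def)
    then obtain I where I: "I \<subseteq> {n..}" "finite I" "B = x ` I"
      by (meson finite_subset_image)
    obtain m where "\<forall>i\<in>I. i < m"
      using I(2) finite_nat_set_iff_bounded by blast
    then have "B \<subseteq> x ` {n..<m}" using I by auto
    moreover have "y \<in> span B"
      using b by (auto simp: span_def)
    ultimately show ?thesis
      using span_is_monotone by blast
  qed
  \<comment> \<open>Head and tail spans meet only in zero. The induction removes the last vector of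
    the tail: a nonzero coefficient there would put that vector into the span of its
    predecessors.\<close>
  have indep: "y \<in> span (x ` {n..<m}) \<Longrightarrow> y \<in> S n \<Longrightarrow> y = \<zero>\<^bsub>V\<^esub>" for y n m
  proof (induction m)
    case 0
    then show ?case by (simp add: span_empty)
  next
    case (Suc m)
    show ?case
    proof (cases "n \<le> m")
      case False
      then show ?thesis using Suc by (simp add: span_empty)
    next
      case True
      then have "y \<in> span (insert (x m) (x ` {n..<m}))"
        using Suc.prems by (simp add: atLeastLessThanSuc)
      then obtain a u where au: "a \<in> carrier K" "u \<in> span (x ` {n..<m})" "y = a \<odot>\<^bsub>V\<^esub> x m \<oplus>\<^bsub>V\<^esub> u"
        using span_insert_cases[OF xA x(1)] by blast
      have u: "u \<in> S m" "y \<in> S m"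
      proof -
        have "x ` {n..<m} \<subseteq> x ` {..<m}" "x ` {..<n} \<subseteq> x ` {..<m}" using True by auto
        then show "u \<in> S m" "y \<in> S m"
          using au(2) Suc.prems(2) span_is_monotone unfolding S_def by blast+
      qed
      have uV: "u \<in> carrier V" using u subspaceD(1)[OF S] by auto
      have "a = \<zero>\<^bsub>K\<^esub>"
      proof (rule ccontr)
        assume a: "a \<noteq> \<zero>\<^bsub>K\<^esub>"
        have "a \<odot>\<^bsub>V\<^esub> x m = y \<ominus>\<^bsub>V\<^esub> u"
          using au uV x by (simp add: add_diff_cancel)
        then have "a \<odot>\<^bsub>V\<^esub> x m \<in> S m"
          using u subspaceD(6)[OF S] by auto
        then have "inv\<^bsub>K\<^esub> a \<odot>\<^bsub>V\<^esub> (a \<odot>\<^bsub>V\<^esub> x m) \<in> S m"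
          using subspaceD(4)[OF S] a au(1) by auto
        then have "x m \<in> S m"
          using a au(1) x mult_inverse[OF au(1) x(1) refl a] by simp
        then show False using x(2) by (simp add: S_def)
      qed
      then show ?thesis
        using au Suc.IH Suc.prems(2) uV x by simp
    qed
  qed
  define v where "v = rec_nat \<zero>\<^bsub>V\<^esub> (\<lambda>n w. w \<oplus>\<^bsub>V\<^esub> x n)"
  have v_Suc: "v (Suc n) = v n \<oplus>\<^bsub>V\<^esub> x n" for n by (simp add: v_def)
  have vS: "v n \<in> S n" for n
  proof (induction n)
    case 0
    then show ?case using subspaceD(2)[OF S] by (simp add: v_def)
  next
    case (Suc n)
    have "S n \<subseteq> S (Suc n)"
      unfolding S_def by (rule span_is_monotone) auto
    then show ?case
      using Suc subspaceD(3)[OF S[of "Suc n"]] x_span[of n "{..<Suc n}"]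
      by (auto simp: v_Suc S_def[of "Suc n"])
  qed
  have vV: "v n \<in> carrier V" for n using vS subspaceD(1)[OF S] by blast
  show thesis
  proof (rule that[of v L])
    show "L (Suc n) +>\<^bsub>V\<^esub> v (Suc n) \<subseteq> L n +>\<^bsub>V\<^esub> v n" for n
    proof
      fix z assume "z \<in> L (Suc n) +>\<^bsub>V\<^esub> v (Suc n)"
      then have z: "z \<in> carrier V" "z \<ominus>\<^bsub>V\<^esub> v (Suc n) \<in> L (Suc n)"
        using mem_coset_iff[OF L vV] by auto
      have "L (Suc n) \<subseteq> L n"
        unfolding L_def by (rule span_is_monotone) auto
      moreover have "x n \<in> L n" using x_span[of n "{n..}"] by (simp add: L_def)
      moreover have "z \<ominus>\<^bsub>V\<^esub> v n = (z \<ominus>\<^bsub>V\<^esub> v (Suc n)) \<oplus>\<^bsub>V\<^esub> x n"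
      proof -
        have "v (Suc n) \<ominus>\<^bsub>V\<^esub> v n = x n"
          using vV x M.a_comm[of "v n" "x n"] by (simp add: v_Suc add_diff_cancel)
        then show ?thesis
          using diff_add_diff[OF z(1) vV[of "Suc n"] vV[of n]] by simp
      qed
      ultimately have "z \<ominus>\<^bsub>V\<^esub> v n \<in> L n"
        using z subspaceD(3)[OF L[of n]] by auto
      then show "z \<in> L n +>\<^bsub>V\<^esub> v n"
        using z mem_coset_iff[OF L vV] by auto
    qed
    show "(\<Inter>n. L n +>\<^bsub>V\<^esub> v n) = {}"
    proof (rule ccontr)
      assume "(\<Inter>n. L n +>\<^bsub>V\<^esub> v n) \<noteq> {}"
      then obtain z where "\<And>n. z \<in> L n +>\<^bsub>V\<^esub> v n" by blast
      then have z: "z \<in> carrier V" "\<And>n. z \<ominus>\<^bsub>V\<^esub> v n \<in> L n"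
        using mem_coset_iff[OF L vV] by auto
      \<comment> \<open>As \<open>v 0\<close> is zero, z is a combination of the first N vectors for
        some N. Then z minus \<open>v (Suc N)\<close> lies in both the head and the tail at
        \<open>Suc N\<close>, hence vanishes, and subtracting \<open>v N\<close> puts
        \<open>x N\<close> into the span of its predecessors.\<close>
      have "z \<in> L 0" using z(2)[of 0] z(1) by (simp add: v_def diff_zero)
      then obtain N where "z \<in> S N"
        using L_finite[of z 0] by (auto simp: S_def atLeast0LessThan)
      moreover have "S N \<subseteq> S (Suc N)"
        unfolding S_def by (rule span_is_monotone) auto
      ultimately have "z \<ominus>\<^bsub>V\<^esub> v (Suc N) \<in> S (Suc N)"
        using vS subspaceD(6)[OF S] by blast
      then have "z \<ominus>\<^bsub>V\<^esub> v (Suc N) = \<zero>\<^bsub>V\<^esub>"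
        using L_finite[OF z(2)] indep by blast
      then have "z = x N \<oplus>\<^bsub>V\<^esub> v N"
        using z vV x M.a_comm[of "v N" "x N"] by (simp add: v_Suc)
      then have "x N = z \<ominus>\<^bsub>V\<^esub> v N"
        using x vV by (simp add: add_diff_cancel)
      then have "x N \<in> S N"
        using \<open>z \<in> S N\<close> vS subspaceD(6)[OF S] by auto
      then show False using x(2) by (simp add: S_def)
    qed
  qed (use L vV in auto)
qed

end

section \<open>Translations and open subspaces\<close>

locale topological_vs = vectorspace K V for K V +
  fixes T
  assumes topological: "topological_vectorspace K V T"
begin

lemma topspace_eq: "topspace T = carrier V"
  and continuous_add: "continuous_map (prod_topology T T) T (\<lambda>(v, w). v \<oplus>\<^bsub>V\<^esub> w)"
  and continuous_smult:
    "continuous_map (prod_topology (discrete_topology (carrier K)) T) T (\<lambda>(a, v). a \<odot>\<^bsub>V\<^esub> v)"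
  using topological by (auto simp: topological_vectorspace_def)

lemma openin_vimage_translation:
  assumes S: "openin T S" and a: "a \<in> carrier V"
  shows "openin T {v \<in> carrier V. v \<oplus>\<^bsub>V\<^esub> a \<in> S}"
proof -
  have "continuous_map T (prod_topology T T) (\<lambda>v. (v, a))"
    using a by (intro continuous_map_pairedI) (auto simp: topspace_eq)
  from continuous_map_compose[OF this continuous_add]
  have "continuous_map T T (\<lambda>v. v \<oplus>\<^bsub>V\<^esub> a)" by (simp add: o_def)
  from openin_continuous_map_preimage[OF this S] show ?thesis
    by (simp add: topspace_eq)
qed

lemma openin_coset:
  assumes S: "openin T S" and a: "a \<in> carrier V"
  shows "openin T (S +>\<^bsub>V\<^esub> a)"
proof -
  have SV: "S \<subseteq> carrier V" using openin_subset[OF S] by (simp add: topspace_eq)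
  have "v \<oplus>\<^bsub>V\<^esub> \<ominus>\<^bsub>V\<^esub> a \<in> S \<longleftrightarrow> v \<in> S +>\<^bsub>V\<^esub> a" if "v \<in> carrier V" for v
    using that a SV add_diff_cancel diff_add_cancel[of v a]
    unfolding a_minus_def a_r_coset_eq by (auto simp: image_iff subset_iff intro: bexI[of _ "v \<oplus>\<^bsub>V\<^esub> \<ominus>\<^bsub>V\<^esub> a"])
  moreover have "S +>\<^bsub>V\<^esub> a \<subseteq> carrier V" using SV a by (auto simp: a_r_coset_eq)
  ultimately have "S +>\<^bsub>V\<^esub> a = {v \<in> carrier V. v \<oplus>\<^bsub>V\<^esub> \<ominus>\<^bsub>V\<^esub> a \<in> S}" by auto
  then show ?thesis
    using openin_vimage_translation[OF S, of "\<ominus>\<^bsub>V\<^esub> a"] a by simp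
qed

text \<open>\<open>S\<close> is the union of the translates of \<open>U\<close> by its
  elements.\<close>

lemma openin_subspace_superset:
  assumes U: "openin T U" "\<zero>\<^bsub>V\<^esub> \<in> U" and S: "VectorSpace.subspace K S V" and "U \<subseteq> S"
  shows "openin T S"
proof -
  have "S = (\<Union>s\<in>S. U +>\<^bsub>V\<^esub> s)"
  proof
    show "S \<subseteq> (\<Union>s\<in>S. U +>\<^bsub>V\<^esub> s)"
      using subspaceD(1)[OF S] U(2) by (force simp: a_r_coset_eq)
    show "(\<Union>s\<in>S. U +>\<^bsub>V\<^esub> s) \<subseteq> S"
      using subspaceD(3)[OF S] assms(4) by (auto simp: a_r_coset_eq)
  qed
  also have "openin T \<dots>"
    using subspaceD(1)[OF S] by (intro openin_Union) (auto intro!: openin_coset U(1))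
  finally show ?thesis .
qed

text \<open>The complement is a union of cosets, each of them open.\<close>

lemma closedin_open_subspace:
  assumes S: "VectorSpace.subspace K S V" and "openin T S"
  shows "closedin T S"
proof -
  have "carrier V - S = (\<Union>v\<in>carrier V - S. S +>\<^bsub>V\<^esub> v)"
  proof
    show "carrier V - S \<subseteq> (\<Union>v\<in>carrier V - S. S +>\<^bsub>V\<^esub> v)"
      using mem_coset_self[OF S] by blast
    show "(\<Union>v\<in>carrier V - S. S +>\<^bsub>V\<^esub> v) \<subseteq> carrier V - S"
    proof clarify
      fix v x assume v: "v \<in> carrier V" "v \<notin> S" and x: "x \<in> S +>\<^bsub>V\<^esub> v"
      then have c: "x \<in> carrier V" "x \<ominus>\<^bsub>V\<^esub> v \<in> S" by (auto simp: mem_coset_iff[OF S])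
      have "x \<notin> S"
        using subspaceD(6)[OF S _ c(2), of x] diff_diff_cancel[OF c(1) v(1)] v(2) by auto
      then show "x \<in> carrier V - S" using c by auto
    qed
  qed
  also have "openin T \<dots>"
    by (intro openin_Union) (auto intro!: openin_coset assms(2))
  finally show ?thesis
    using subspaceD(1)[OF S] by (simp add: closedin_def topspace_eq)
qed

lemma topological_vectorspace_subspace:
  assumes S: "VectorSpace.subspace K S V"
  shows "topological_vectorspace K (V\<lparr>carrier := S\<rparr>) (subtopology T S)"
proof -
  have "continuous_map (prod_topology (subtopology T S) (subtopology T S)) (subtopology T S)
      (\<lambda>(v, w). v \<oplus>\<^bsub>V\<^esub> w)"
    unfolding subtopology_Times[symmetric] continuous_map_in_subtopology
    using subspaceD(3)[OF S] continuous_map_from_subtopology[OF continuous_add] by auto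
  moreover have "continuous_map (prod_topology (discrete_topology (carrier K)) (subtopology T S))
      (subtopology T S) (\<lambda>(a, v). a \<odot>\<^bsub>V\<^esub> v)"
  proof -
    have "prod_topology (discrete_topology (carrier K)) (subtopology T S) =
        subtopology (prod_topology (discrete_topology (carrier K)) T) (carrier K \<times> S)"
      by (simp add: subtopology_Times)
    then show ?thesis
      using subspaceD(4)[OF S] continuous_map_from_subtopology[OF continuous_smult]
      by (auto simp: continuous_map_in_subtopology)
  qed
  moreover have "topspace (subtopology T S) = S"
    using subspaceD(1)[OF S] by (auto simp: topspace_eq)
  ultimately show ?thesis
    using subspace_is_vs[OF S] by (simp add: topological_vectorspace_def)
qed

end

section \<open>Permanence and consequences of linear compactness\<close>

lemma linearly_topologizedD:
  assumes "linearly_topologized K V T"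
  shows "topological_vs K V T"
  using assms by (auto simp: linearly_topologized_def topological_vectorspace_def topological_vs_def
      topological_vs_axioms_def)

lemma linearly_topologized_subspace:
  assumes V: "linearly_topologized K V T" and S: "VectorSpace.subspace K S V"
  shows "linearly_topologized K (V\<lparr>carrier := S\<rparr>) (subtopology T S)"
proof -
  interpret topological_vs K V T by (rule linearly_topologizedD[OF V])
  have "neighbourhood_base_at \<zero>\<^bsub>V\<^esub> (\<lambda>U. VectorSpace.subspace K U (V\<lparr>carrier := S\<rparr>)) (subtopology T S)"
    unfolding neighbourhood_base_at_def
  proof (intro allI impI)
    fix N assume "openin (subtopology T S) N \<and> \<zero>\<^bsub>V\<^esub> \<in> N"
    then obtain N' where N': "openin T N'" "N = N' \<inter> S" "\<zero>\<^bsub>V\<^esub> \<in> N'"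
      by (auto simp: openin_subtopology)
    then obtain U U' where U: "openin T U" "VectorSpace.subspace K U' V" "\<zero>\<^bsub>V\<^esub> \<in> U" "U \<subseteq> U'" "U' \<subseteq> N'"
      using V unfolding linearly_topologized_def neighbourhood_base_at_def by metis
    have "VectorSpace.subspace K (U' \<inter> S) (V\<lparr>carrier := S\<rparr>)"
      using subspace_carrier_update[OF S] subspace_Int[OF U(2) S] by auto
    moreover have "openin (subtopology T S) (U \<inter> S)"
      using U(1) by (auto simp: openin_subtopology)
    ultimately show "\<exists>U U'. openin (subtopology T S) U \<and> VectorSpace.subspace K U' (V\<lparr>carrier := S\<rparr>) \<and>
        \<zero>\<^bsub>V\<^esub> \<in> U \<and> U \<subseteq> U' \<and> U' \<subseteq> N"
      using U N' subspaceD(2)[OF S] by (intro exI[of _ "U \<inter> S"] exI[of _ "U' \<inter> S"]) auto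
  qed
  then show ?thesis
    using V topological_vectorspace_subspace[OF S]
    by (simp add: linearly_topologized_def Hausdorff_space_subtopology)
qed

text \<open>Closed varieties of \<open>S\<close> are closed varieties of \<open>V\<close>, and
  \<open>S\<close> itself is one. Adding \<open>S\<close> to the family forces the common point into
  \<open>S\<close>, even for the empty family.\<close>

lemma linearly_compact_closed_subspace:
  assumes V: "linearly_compact K V T" and S: "VectorSpace.subspace K S V" and cl: "closedin T S"
  shows "linearly_compact K (V\<lparr>carrier := S\<rparr>) (subtopology T S)"
proof -
  have lt: "linearly_topologized K V T" using V by (simp add: linearly_compact_def)
  interpret topological_vs K V T by (rule linearly_topologizedD[OF lt])
  have S_var: "closed_linear_variety K V T S"
    unfolding closed_linear_variety_def using S cl coset_zero[OF S] by (metis M.zero_closed)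
  show ?thesis
    unfolding linearly_compact_def
  proof (intro conjI allI impI linearly_topologized_subspace lt S; elim conjE)
    fix \<A> assume \<A>: "\<forall>A\<in>\<A>. closed_linear_variety K (V\<lparr>carrier := S\<rparr>) (subtopology T S) A"
      and fip: "\<forall>\<F>. finite \<F> \<and> \<F> \<subseteq> \<A> \<longrightarrow> carrier (V\<lparr>carrier := S\<rparr>) \<inter> \<Inter>\<F> \<noteq> {}"
    have "closed_linear_variety K V T A" if A: "A \<in> \<A>" for A
    proof -
      obtain v L where "v \<in> S" "VectorSpace.subspace K L (V\<lparr>carrier := S\<rparr>)"
        "closedin (subtopology T S) L" "A = L +>\<^bsub>V\<^esub> v"
        using \<A> A by (auto simp: closed_linear_variety_def)
      then have "v \<in> carrier V" "VectorSpace.subspace K L V" "closedin T L" "A = L +>\<^bsub>V\<^esub> v"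
        using subspaceD(1)[OF S] closedin_trans_full[OF _ cl] subspace_carrier_update[OF S] by auto
      then show ?thesis unfolding closed_linear_variety_def by blast
    qed
    then have var: "\<forall>A\<in>insert S \<A>. closed_linear_variety K V T A" using S_var by blast
    have "\<forall>\<F>. finite \<F> \<and> \<F> \<subseteq> insert S \<A> \<longrightarrow> carrier V \<inter> \<Inter>\<F> \<noteq> {}"
    proof (intro allI impI)
      fix \<F> assume \<F>: "finite \<F> \<and> \<F> \<subseteq> insert S \<A>"
      \<comment> \<open>\<open>S\<close> is removed because the intersection property is known only
        for subfamilies of the original family.\<close>
      then have "S \<inter> \<Inter>(\<F> - {S}) \<noteq> {}"
        using fip[rule_format, of "\<F> - {S}"] by auto
      then show "carrier V \<inter> \<Inter>\<F> \<noteq> {}"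
        using subspaceD(1)[OF S] by auto
    qed
    with V var have "carrier V \<inter> \<Inter>(insert S \<A>) \<noteq> {}"
      unfolding linearly_compact_def by blast
    then show "carrier (V\<lparr>carrier := S\<rparr>) \<inter> \<Inter>\<A> \<noteq> {}" by auto
  qed
qed

text \<open>Closed varieties pull back to closed varieties; surjectivity carries the finite
  intersection property back and ensures that the preimage of a coset is again a coset.\<close>

lemma linearly_compact_image:
  assumes V: "linearly_compact K V T" and V': "linearly_topologized K V' T'"
    and f: "linear_map K V V' f" "continuous_map T T' f" "f ` carrier V = carrier V'"
  shows "linearly_compact K V' T'"
proof -
  have lt: "linearly_topologized K V T" using V by (simp add: linearly_compact_def)
  interpret V: topological_vs K V T by (rule linearly_topologizedD[OF lt])
  interpret f: linear_map K V V' f by fact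
  let ?pre = "\<lambda>A. {x \<in> carrier V. f x \<in> A}"
  show ?thesis
    unfolding linearly_compact_def
  proof (intro conjI allI impI V'; elim conjE)
    fix \<A> assume \<A>: "\<forall>A\<in>\<A>. closed_linear_variety K V' T' A"
      and fip: "\<forall>\<F>. finite \<F> \<and> \<F> \<subseteq> \<A> \<longrightarrow> carrier V' \<inter> \<Inter>\<F> \<noteq> {}"
    have "closed_linear_variety K V T (?pre A)" if A: "A \<in> \<A>" for A
    proof -
      obtain y L where L: "y \<in> carrier V'" "VectorSpace.subspace K L V'" "closedin T' L" "A = L +>\<^bsub>V'\<^esub> y"
        using \<A> A unfolding closed_linear_variety_def by blast
      then obtain v where v: "v \<in> carrier V" "y = f v" using f(3) by blast
      have "VectorSpace.subspace K (?pre L) V"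
        by (rule f.subspace_vimage[OF L(2)])
      moreover have "closedin T (?pre L)"
        using closedin_continuous_map_preimage[OF f(2) L(3)] by (simp add: V.topspace_eq)
      moreover have "?pre A = ?pre L +>\<^bsub>V\<^esub> v"
        unfolding L(4) v(2) by (rule V.vimage_coset[OF f(1) L(2) v(1)])
      ultimately show ?thesis
        using v(1) unfolding closed_linear_variety_def by blast
    qed
    then have "\<forall>A\<in>?pre ` \<A>. closed_linear_variety K V T A" by blast
    moreover have "\<forall>\<F>. finite \<F> \<and> \<F> \<subseteq> ?pre ` \<A> \<longrightarrow> carrier V \<inter> \<Inter>\<F> \<noteq> {}"
    proof (intro allI impI)
      fix \<F> assume "finite \<F> \<and> \<F> \<subseteq> ?pre ` \<A>"
      then obtain \<G> where \<G>: "finite \<G>" "\<G> \<subseteq> \<A>" "\<F> = ?pre ` \<G>"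
        by (meson finite_subset_image)
      then have "carrier V' \<inter> \<Inter>\<G> \<noteq> {}"
        using fip by simp
      then obtain y where "y \<in> carrier V'" "\<forall>A\<in>\<G>. y \<in> A" by blast
      then obtain v where "v \<in> carrier V" "\<forall>A\<in>\<G>. f v \<in> A"
        unfolding f(3)[symmetric] by blast
      then have "v \<in> carrier V \<inter> \<Inter>\<F>" unfolding \<G>(3) by blast
      then show "carrier V \<inter> \<Inter>\<F> \<noteq> {}" by blast
    qed
    ultimately have "carrier V \<inter> \<Inter>(?pre ` \<A>) \<noteq> {}"
      using V unfolding linearly_compact_def by meson
    then obtain x where "x \<in> carrier V" "\<forall>A\<in>\<A>. f x \<in> A" by blast
    then have "f x \<in> carrier V' \<inter> \<Inter>\<A>" using f.f_closed by simp
    then show "carrier V' \<inter> \<Inter>\<A> \<noteq> {}" by blast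
  qed
qed

text \<open>In infinite dimension the nested cosets with empty intersection pull back from V/U to
  \<open>V\<close> and contradict linear compactness. Their direction spaces contain the open
  \<open>U\<close>, hence are open and therefore closed.\<close>

lemma linearly_compact_fin_dim_quotient:
  assumes V: "linearly_compact K V T" and U: "VectorSpace.subspace K U V" "openin T U"
  shows "vectorspace.fin_dim K (quotient_space V U)"
proof (rule ccontr)
  assume nf: "\<not> vectorspace.fin_dim K (quotient_space V U)"
  have lt: "linearly_topologized K V T" using V by (simp add: linearly_compact_def)
  interpret V: topological_vs K V T by (rule linearly_topologizedD[OF lt])
  let ?p = "\<lambda>v. U +>\<^bsub>V\<^esub> v" and ?Q = "quotient_space V U"
  interpret p: linear_map K V ?Q ?p by (rule V.linear_coset_map[OF U(1)])
  obtain y L where y: "\<And>n::nat. y n \<in> carrier ?Q" and L: "\<And>n. VectorSpace.subspace K (L n) ?Q"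
    and dec: "\<And>n. L (Suc n) +>\<^bsub>?Q\<^esub> y (Suc n) \<subseteq> L n +>\<^bsub>?Q\<^esub> y n" and emp: "(\<Inter>n. L n +>\<^bsub>?Q\<^esub> y n) = {}"
    by (rule p.W.infinite_dim_nested_cosets[OF nf]) (rule that)
  define A where "A n = {x \<in> carrier V. ?p x \<in> L n +>\<^bsub>?Q\<^esub> y n}" for n
  have y_ex: "\<exists>v. v \<in> carrier V \<and> y n = ?p v" for n using y[of n] by auto
  have var: "closed_linear_variety K V T (A n)" for n
  proof -
    obtain v where v: "v \<in> carrier V" "y n = ?p v" using y_ex by blast
    let ?L = "{x \<in> carrier V. ?p x \<in> L n}"
    have sub: "VectorSpace.subspace K ?L V"
      by (rule p.subspace_vimage[OF L])
    have "U \<subseteq> ?L"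
    proof
      fix x assume x: "x \<in> U"
      then have "x \<in> carrier V" "?p x = \<zero>\<^bsub>?Q\<^esub>"
        using V.subspaceD(1)[OF U(1)] V.coset_eq_self_iff[OF U(1), of x] by auto
      then show "x \<in> ?L" using p.W.subspaceD(2)[OF L[of n]] by (metis (mono_tags, lifting) mem_Collect_eq)
    qed
    then have "openin T ?L"
      by (rule V.openin_subspace_superset[OF U(2) V.subspaceD(2)[OF U(1)] sub])
    then have "closedin T ?L" by (rule V.closedin_open_subspace[OF sub])
    moreover have "A n = ?L +>\<^bsub>V\<^esub> v"
      unfolding A_def v(2) by (rule V.vimage_coset[OF p.linear_map_axioms L v(1)])
    ultimately show ?thesis
      using sub v(1) unfolding closed_linear_variety_def by blast
  qed
  have ne: "A n \<noteq> {}" for n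
  proof -
    obtain v where v: "v \<in> carrier V" "y n = ?p v" using y_ex by blast
    then have "v \<in> A n"
      using p.W.mem_coset_self[OF L[of n] y[of n]] by (simp add: A_def del: quotient_space_simps)
    then show ?thesis by blast
  qed
  have A_anti: "A n \<subseteq> A m" if "m \<le> n" for m n
    by (rule lift_Suc_antimono_le[OF _ that]) (use dec in \<open>auto simp: A_def\<close>)
  have "\<forall>\<F>. finite \<F> \<and> \<F> \<subseteq> range A \<longrightarrow> carrier V \<inter> \<Inter>\<F> \<noteq> {}"
  proof (intro allI impI)
    fix \<F> assume "finite \<F> \<and> \<F> \<subseteq> range A"
    then obtain I where I: "finite I" "\<F> = A ` I" by (meson finite_subset_image)
    then obtain n where "\<forall>i\<in>I. i \<le> n"
      using finite_nat_set_iff_bounded_le by blast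
    then have "A n \<subseteq> \<Inter>\<F>" using A_anti I by auto
    moreover have "A n \<subseteq> carrier V" by (auto simp: A_def)
    ultimately show "carrier V \<inter> \<Inter>\<F> \<noteq> {}" using ne[of n] by blast
  qed
  moreover have "\<forall>B\<in>range A. closed_linear_variety K V T B" using var by simp
  ultimately have "carrier V \<inter> \<Inter>(range A) \<noteq> {}"
    using V unfolding linearly_compact_def by meson
  then show False using emp by (auto simp: A_def)
qed

section \<open>The topology of quotients\<close>

text \<open>A product of quotient maps need not be a quotient map, but open surjections are stable
  under products: open boxes go to open boxes. This lets both vector space operations descend to the
  quotient.\<close>

lemma continuous_map_prod_open_maps:
  assumes g: "continuous_map (prod_topology X Y) Z (\<lambda>(x, y). g (q x, r y))"
    and q: "open_map X X' q" "q ` topspace X = topspace X'"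
    and r: "open_map Y Y' r" "r ` topspace Y = topspace Y'"
  shows "continuous_map (prod_topology X' Y') Z g"
  unfolding continuous_map
proof (intro conjI allI impI)
  show "g ` topspace (prod_topology X' Y') \<subseteq> topspace Z"
  proof -
    have "g (q x, r y) \<in> topspace Z" if "x \<in> topspace X" "y \<in> topspace Y" for x y
      using continuous_map_image_subset_topspace[OF g] that by force
    then show ?thesis by (auto simp flip: q(2) r(2))
  qed
  fix N assume N: "openin Z N"
  have op: "openin (prod_topology X Y) {z \<in> topspace X \<times> topspace Y. (\<lambda>(x, y). g (q x, r y)) z \<in> N}"
    using openin_continuous_map_preimage[OF g N] by simp
  show "openin (prod_topology X' Y') {z \<in> topspace (prod_topology X' Y'). g z \<in> N}"
    unfolding openin_prod_topology_alt
  proof (intro allI impI)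
    fix a b assume "(a, b) \<in> {z \<in> topspace (prod_topology X' Y'). g z \<in> N}"
    then have ab: "a \<in> topspace X'" "b \<in> topspace Y'" "g (a, b) \<in> N" by auto
    then obtain x y where xy: "x \<in> topspace X" "a = q x" "y \<in> topspace Y" "b = r y"
      unfolding q(2)[symmetric] r(2)[symmetric] by blast
    then obtain A B where AB: "openin X A" "openin Y B" "x \<in> A" "y \<in> B"
      "A \<times> B \<subseteq> {z \<in> topspace X \<times> topspace Y. (\<lambda>(x, y). g (q x, r y)) z \<in> N}"
    proof -
      have "(x, y) \<in> {z \<in> topspace X \<times> topspace Y. (\<lambda>(x, y). g (q x, r y)) z \<in> N}"
        using xy ab(3) by simp
      then have "\<exists>A B. openin X A \<and> openin Y B \<and> x \<in> A \<and> y \<in> B \<and>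
          A \<times> B \<subseteq> {z \<in> topspace X \<times> topspace Y. (\<lambda>(x, y). g (q x, r y)) z \<in> N}"
        by (rule op[unfolded openin_prod_topology_alt, rule_format])
      then show ?thesis using that by (elim exE conjE)
    qed
    have "openin X' (q ` A)" "openin Y' (r ` B)"
      using q(1) r(1) AB(1,2) by (auto simp: open_map_def)
    moreover have "q ` A \<times> r ` B \<subseteq> {z \<in> topspace (prod_topology X' Y'). g z \<in> N}"
    proof
      fix z assume "z \<in> q ` A \<times> r ` B"
      then obtain u w where uw: "(u, w) \<in> A \<times> B" "z = (q u, r w)" by blast
      then have "u \<in> topspace X" "w \<in> topspace Y" "g z \<in> N" using AB(5) by auto
      then show "z \<in> {z \<in> topspace (prod_topology X' Y'). g z \<in> N}"
        using uw(2) q(2) r(2) by auto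
    qed
    ultimately show "\<exists>A B. openin X' A \<and> openin Y' B \<and> a \<in> A \<and> b \<in> B \<and>
        A \<times> B \<subseteq> {z \<in> topspace (prod_topology X' Y'). g z \<in> N}"
      using AB xy by blast
  qed
qed

locale topological_vs_quotient = topological_vs +
  fixes W
  assumes W: "VectorSpace.subspace K W V"
begin

abbreviation "VW \<equiv> quotient_space V W"
abbreviation "TW \<equiv> quotient_topology V T W"
abbreviation "p \<equiv> (\<lambda>v. W +>\<^bsub>V\<^esub> v)"

sublocale p: linear_map K V VW p
  by (rule linear_coset_map[OF W])

lemma quotient_map_p: "quotient_map T TW p"
  by (rule quotient_map_quotient_topology[OF topspace_eq])

lemma continuous_p: "continuous_map T TW p"
  by (rule quotient_imp_continuous_map[OF quotient_map_p])

lemma topspace_quotient: "topspace TW = p ` carrier V"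
  using quotient_imp_surjective_map[OF quotient_map_p] by (simp add: topspace_eq)

lemma openin_quotient_iff:
  "openin TW Y \<longleftrightarrow> Y \<subseteq> p ` carrier V \<and> openin T {v \<in> carrier V. p v \<in> Y}"
  using quotient_map_p openin_subset[of TW Y]
  by (auto simp: quotient_map_def topspace_eq topspace_quotient)

text \<open>The saturation of \<open>S\<close> is the union of its translates by elements of
  \<open>W\<close>.\<close>

lemma open_map_p: "open_map T TW p"
  unfolding open_map_def
proof (intro allI impI)
  fix S assume S: "openin T S"
  have SV: "S \<subseteq> carrier V" using openin_subset[OF S] by (simp add: topspace_eq)
  have "{v \<in> carrier V. p v \<in> p ` S} = (\<Union>w\<in>W. S +>\<^bsub>V\<^esub> w)"
  proof
    show "{v \<in> carrier V. p v \<in> p ` S} \<subseteq> (\<Union>w\<in>W. S +>\<^bsub>V\<^esub> w)"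
    proof clarify
      fix v s assume vs: "v \<in> carrier V" "s \<in> S" "p v = p s"
      then have "v \<ominus>\<^bsub>V\<^esub> s \<in> W" "s \<in> carrier V" using SV coset_eq_iff[OF W] by auto
      moreover then have "v = s \<oplus>\<^bsub>V\<^esub> (v \<ominus>\<^bsub>V\<^esub> s)"
        using vs(1) diff_add_cancel[of v s] M.a_comm[of s "v \<ominus>\<^bsub>V\<^esub> s"] by simp
      ultimately show "v \<in> (\<Union>w\<in>W. S +>\<^bsub>V\<^esub> w)"
        using vs(2) by (auto simp: a_r_coset_eq)
    qed
    show "(\<Union>w\<in>W. S +>\<^bsub>V\<^esub> w) \<subseteq> {v \<in> carrier V. p v \<in> p ` S}"
    proof clarify
      fix w v assume w: "w \<in> W" "v \<in> S +>\<^bsub>V\<^esub> w"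
      then obtain s where s: "s \<in> S" "v = s \<oplus>\<^bsub>V\<^esub> w" by (auto simp: a_r_coset_eq)
      then have c: "s \<in> carrier V" "w \<in> carrier V" using w SV subspaceD(1)[OF W] by auto
      then have "v \<ominus>\<^bsub>V\<^esub> s = w"
        using s M.a_comm[of s w] by (simp add: add_diff_cancel)
      then have "p v = p s"
        using c s w coset_eq_iff[OF W, of v s] by auto
      then show "v \<in> carrier V \<and> p v \<in> p ` S" using c s by auto
    qed
  qed
  moreover have "openin T (\<Union>w\<in>W. S +>\<^bsub>V\<^esub> w)"
    using subspaceD(1)[OF W] by (intro openin_Union) (auto intro!: openin_coset S)
  ultimately show "openin TW (p ` S)"
    using SV by (auto simp: openin_quotient_iff)
qed

lemma topological_quotient: "topological_vectorspace K VW TW"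
proof -
  have surj: "p ` topspace T = topspace TW" by (simp add: topspace_quotient topspace_eq)
  have "continuous_map (prod_topology TW TW) TW (\<lambda>(v, w). v \<oplus>\<^bsub>VW\<^esub> w)"
  proof (rule continuous_map_prod_open_maps[OF _ open_map_p surj open_map_p surj])
    show "continuous_map (prod_topology T T) TW (\<lambda>(x, y). case (p x, p y) of (v, w) \<Rightarrow> v \<oplus>\<^bsub>VW\<^esub> w)"
    proof (rule continuous_map_eq[OF continuous_map_compose[OF continuous_add continuous_p]])
      fix z assume "z \<in> topspace (prod_topology T T)"
      then show "(p \<circ> (\<lambda>(v, w). v \<oplus>\<^bsub>V\<^esub> w)) z = (case z of (x, y) \<Rightarrow> case (p x, p y) of (v, w) \<Rightarrow> v \<oplus>\<^bsub>VW\<^esub> w)"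
        using coset_add[OF W] by (auto simp: topspace_eq)
    qed
  qed
  moreover have "continuous_map (prod_topology (discrete_topology (carrier K)) TW) TW (\<lambda>(a, v). a \<odot>\<^bsub>VW\<^esub> v)"
  proof (rule continuous_map_prod_open_maps[OF _ _ _ open_map_p surj])
    show "continuous_map (prod_topology (discrete_topology (carrier K)) T) TW
        (\<lambda>(x, y). case (id x, p y) of (a, v) \<Rightarrow> a \<odot>\<^bsub>VW\<^esub> v)"
    proof (rule continuous_map_eq[OF continuous_map_compose[OF continuous_smult continuous_p]])
      fix z assume "z \<in> topspace (prod_topology (discrete_topology (carrier K)) T)"
      then show "(p \<circ> (\<lambda>(a, v). a \<odot>\<^bsub>V\<^esub> v)) z = (case z of (x, y) \<Rightarrow> case (id x, p y) of (a, v) \<Rightarrow> a \<odot>\<^bsub>VW\<^esub> v)"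
        using quotient_smult[OF W] by (auto simp: topspace_eq simp del: quotient_space_simps)
    qed
  qed (auto simp: open_map_def)
  ultimately show ?thesis
    using topspace_quotient quotient_vectorspace[OF W] by (simp add: topological_vectorspace_def del: quotient_space_simps(2-))
qed

sublocale quotient: topological_vs K VW TW
  by unfold_locales (rule topological_quotient)

text \<open>For d = u - v outside the closed \<open>W\<close>, some open subspace \<open>U\<close>
  has U + d disjoint from \<open>W\<close>. If U + u and U + v met modulo \<open>W\<close>, then (s
  - t) + d would lie in \<open>W\<close> with s - t in \<open>U\<close>.\<close>

lemma Hausdorff_quotient:
  assumes cl: "closedin T W"
    and base: "\<And>N. openin T N \<Longrightarrow> \<zero>\<^bsub>V\<^esub> \<in> N \<Longrightarrow>
      \<exists>U. VectorSpace.subspace K U V \<and> openin T U \<and> U \<subseteq> N"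
  shows "Hausdorff_space TW"
  unfolding Hausdorff_space_def
proof (intro allI impI; elim conjE)
  fix a b assume "a \<in> topspace TW" "b \<in> topspace TW" "a \<noteq> b"
  then obtain u v where uv: "u \<in> carrier V" "v \<in> carrier V" "a = p u" "b = p v" "p u \<noteq> p v"
    unfolding topspace_quotient by blast
  define d where "d = u \<ominus>\<^bsub>V\<^esub> v"
  have d: "d \<in> carrier V" "d \<notin> W"
    using uv coset_eq_iff[OF W, of u v] by (auto simp: d_def)
  have "openin T (carrier V - W)"
    using cl by (simp add: closedin_def topspace_eq)
  then have "openin T {x \<in> carrier V. x \<oplus>\<^bsub>V\<^esub> d \<in> carrier V - W}"
    by (rule openin_vimage_translation[OF _ d(1)])
  then obtain U where U: "VectorSpace.subspace K U V" "openin T U"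
    "U \<subseteq> {x \<in> carrier V. x \<oplus>\<^bsub>V\<^esub> d \<in> carrier V - W}"
    using base d by fastforce
  have UV: "U \<subseteq> carrier V" by (rule subspaceD(1)[OF U(1)])
  have "openin TW (p ` (U +>\<^bsub>V\<^esub> c))" if "c \<in> carrier V" for c
    using open_map_p openin_coset[OF U(2) that] by (simp add: open_map_def)
  moreover have "a \<in> p ` (U +>\<^bsub>V\<^esub> u)" "b \<in> p ` (U +>\<^bsub>V\<^esub> v)"
    using uv mem_coset_self[OF U(1)] by auto
  moreover have "disjnt (p ` (U +>\<^bsub>V\<^esub> u)) (p ` (U +>\<^bsub>V\<^esub> v))"
    unfolding disjnt_iff
  proof (intro allI notI; elim conjE)
    fix y assume "y \<in> p ` (U +>\<^bsub>V\<^esub> u)" "y \<in> p ` (U +>\<^bsub>V\<^esub> v)"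
    then obtain s t where st: "s \<in> U" "t \<in> U" "p (s \<oplus>\<^bsub>V\<^esub> u) = p (t \<oplus>\<^bsub>V\<^esub> v)"
      by (auto simp: a_r_coset_eq)
    then have c: "s \<in> carrier V" "t \<in> carrier V" using UV by auto
    then have "(s \<ominus>\<^bsub>V\<^esub> t) \<oplus>\<^bsub>V\<^esub> d \<in> W"
      using st uv coset_eq_iff[OF W, of "s \<oplus>\<^bsub>V\<^esub> u" "t \<oplus>\<^bsub>V\<^esub> v"]
      by (simp add: add_diff_add d_def)
    moreover have "s \<ominus>\<^bsub>V\<^esub> t \<in> U" using st subspaceD(6)[OF U(1)] by auto
    ultimately show False using U(3) by auto
  qed
  ultimately show "\<exists>A B. openin TW A \<and> openin TW B \<and> a \<in> A \<and> b \<in> B \<and> disjnt A B"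
    using uv by blast
qed

text \<open>Images of small open subspaces form the base at zero, since \<open>p\<close> is open.
  Linear compactness of an image includes being linearly topologized, so this precedes any statement
  about open linearly compact subspaces of the quotient.\<close>

lemma linearly_topologized_quotient:
  assumes cl: "closedin T W"
    and base: "\<And>N. openin T N \<Longrightarrow> \<zero>\<^bsub>V\<^esub> \<in> N \<Longrightarrow>
      \<exists>U. VectorSpace.subspace K U V \<and> openin T U \<and> U \<subseteq> N"
  shows "linearly_topologized K VW TW"
proof -
  have "neighbourhood_base_at \<zero>\<^bsub>VW\<^esub> (\<lambda>U. VectorSpace.subspace K U VW) TW"
    unfolding neighbourhood_base_at_def
  proof (intro allI impI; elim conjE)
    fix N assume N: "openin TW N" "\<zero>\<^bsub>VW\<^esub> \<in> N"
    then have "openin T {v \<in> carrier V. p v \<in> N}" "\<zero>\<^bsub>V\<^esub> \<in> {v \<in> carrier V. p v \<in> N}"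
      using p.T0_is_0 by (auto simp: openin_quotient_iff coset_zero[OF W])
    then obtain U where U: "VectorSpace.subspace K U V" "openin T U" "U \<subseteq> {v \<in> carrier V. p v \<in> N}"
      using base by blast
    then have "openin TW (p ` U)" using open_map_p by (simp add: open_map_def)
    moreover have "VectorSpace.subspace K (p ` U) VW" by (rule p.subspace_image[OF U(1)])
    moreover have "p ` U \<subseteq> N" using U(3) by blast
    ultimately show "\<exists>U U'. openin TW U \<and> VectorSpace.subspace K U' VW \<and> \<zero>\<^bsub>VW\<^esub> \<in> U \<and> U \<subseteq> U' \<and> U' \<subseteq> N"
      using p.W.subspaceD(2)[of "p ` U"] by (intro exI[of _ "p ` U"] conjI order_refl)
  qed
  then show ?thesis
    using topological_quotient Hausdorff_quotient[OF assms] by (simp add: linearly_topologized_def)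
qed

lemma lc_open_subspaces_image:
  assumes lt: "linearly_topologized K VW TW" and U: "U \<in> lc_open_subspaces K V T"
  shows "p ` U \<in> lc_open_subspaces K VW TW"
proof -
  have U': "VectorSpace.subspace K U V" "openin T U"
    "linearly_compact K (V\<lparr>carrier := U\<rparr>) (subtopology T U)"
    using U by (auto simp: lc_open_subspaces_def)
  have pU: "VectorSpace.subspace K (p ` U) VW" by (rule p.subspace_image[OF U'(1)])
  have "openin TW (p ` U)"
    using open_map_p U'(2) by (simp add: open_map_def)
  moreover have "linearly_compact K (VW\<lparr>carrier := p ` U\<rparr>) (subtopology TW (p ` U))"
  proof (rule linearly_compact_image[OF U'(3) linearly_topologized_subspace[OF lt pU]])
    show "linear_map K (V\<lparr>carrier := U\<rparr>) (VW\<lparr>carrier := p ` U\<rparr>) p"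
      by (rule p.linear_map_restrict[OF U'(1) pU]) simp
    show "continuous_map (subtopology T U) (subtopology TW (p ` U)) p"
      using continuous_p by (simp add: continuous_map_in_subtopology continuous_map_from_subtopology image_mono)
  qed simp
  ultimately show ?thesis
    using pU by (simp add: lc_open_subspaces_def)
qed

end

text \<open>U \<inter> W is closed in the linearly compact \<open>U\<close> and open in
  \<open>W\<close>; the two ways of inducing its topology agree.\<close>

lemma lc_open_subspaces_Int:
  assumes V: "topological_vectorspace K V T"
    and U: "U \<in> lc_open_subspaces K V T" and W: "VectorSpace.subspace K W V" "closedin T W"
  shows "U \<inter> W \<in> lc_open_subspaces K (V\<lparr>carrier := W\<rparr>) (subtopology T W)"
proof -
  interpret topological_vs K V T
    using V by (auto simp: topological_vs_def topological_vs_axioms_def topological_vectorspace_def)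
  have U': "VectorSpace.subspace K U V" "openin T U"
    "linearly_compact K (V\<lparr>carrier := U\<rparr>) (subtopology T U)"
    using U by (auto simp: lc_open_subspaces_def)
  have sub: "VectorSpace.subspace K (U \<inter> W) V" by (rule subspace_Int[OF U'(1) W(1)])
  have "linearly_compact K (V\<lparr>carrier := U\<rparr>\<lparr>carrier := U \<inter> W\<rparr>) (subtopology (subtopology T U) (U \<inter> W))"
  proof (rule linearly_compact_closed_subspace[OF U'(3)])
    show "VectorSpace.subspace K (U \<inter> W) (V\<lparr>carrier := U\<rparr>)"
      using sub by (simp add: subspace_carrier_update[OF U'(1)])
    show "closedin (subtopology T U) (U \<inter> W)"
      using W(2) by (simp add: closedin_subtopology_Int_closed)
  qed
  moreover have "subtopology (subtopology T U) (U \<inter> W) = subtopology (subtopology T W) (U \<inter> W)"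
    by (simp add: subtopology_subtopology Int_ac)
  moreover have "openin (subtopology T W) (U \<inter> W)"
    using U'(2) by (auto simp: openin_subtopology)
  ultimately show ?thesis
    using sub by (simp add: lc_open_subspaces_def subspace_carrier_update[OF W(1)])
qed

section \<open>The addition theorem\<close>

locale topological_endo = topological_vs K V T + linear_endo K V \<phi> for K V T \<phi> +
  assumes continuous: "continuous_map T T \<phi>"
begin

abbreviation "B \<equiv> lc_open_subspaces K V T"
abbreviation "H \<equiv> local_entropy K V \<phi>"

lemma continuous_funpow: "continuous_map T T (\<phi> ^^ i)"
proof (induction i)
  case 0
  then show ?case by (simp add: id_def)
next
  case (Suc i)
  show ?case
    using continuous_map_compose[OF Suc continuous] by (simp add: o_def)
qed

lemma openin_cotrajectory:
  assumes U: "openin T U"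
  shows "openin T (cotrajectory \<phi> U n)"
proof (induction n)
  case 0
  then show ?case using U by (simp add: cotrajectory_def)
next
  case (Suc n)
  have "cotrajectory \<phi> U (Suc n) = cotrajectory \<phi> U n \<inter> {x \<in> topspace T. (\<phi> ^^ n) x \<in> U}"
    using openin_subset[OF U] by (auto simp: mem_cotrajectory_iff less_Suc_eq)
  then show ?case
    using Suc openin_continuous_map_preimage[OF continuous_funpow U] by auto
qed

text \<open>Here linear compactness turns into finite dimension; every finiteness premise of the
  algebraic part is discharged through this.\<close>

lemma fin_codim_open:
  assumes U: "U \<in> B" and G: "sub G" "openin T G" "G \<subseteq> U"
  shows "fin_codim K V U G"
proof -
  have U': "sub U" "linearly_compact K (V\<lparr>carrier := U\<rparr>) (subtopology T U)"
    using U by (auto simp: lc_open_subspaces_def)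
  show ?thesis
    unfolding fin_codim_def
  proof (rule linearly_compact_fin_dim_quotient[OF U'(2)])
    show "VectorSpace.subspace K G (V\<lparr>carrier := U\<rparr>)"
      using G subspace_carrier_update[OF U'(1)] by simp
    show "openin (subtopology T U) G"
      using G by (metis Int_absorb2 openin_subtopology)
  qed
qed

lemma lc_open_subspaceD: "U \<in> B \<Longrightarrow> sub U" "U \<in> B \<Longrightarrow> openin T U"
  by (auto simp: lc_open_subspaces_def)

lemma fin_codim_cotrajectory:
  assumes "U \<in> B" "U' \<in> B" "U' \<subseteq> U"
  shows "fin_codim K V U (cotrajectory \<phi> U' n)"
  using assms cotrajectory_subset[of \<phi> U' n]
  by (intro fin_codim_open sub_cotrajectory openin_cotrajectory) (auto intro: lc_open_subspaceD)

lemma H_antimono: "U \<in> B \<Longrightarrow> U' \<in> B \<Longrightarrow> U' \<subseteq> U \<Longrightarrow> H U \<le> H U'"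
  by (intro local_entropy_antimono fin_codim_cotrajectory lc_open_subspaceD)

lemma H_nonneg: "U \<in> B \<Longrightarrow> 0 \<le> H U"
  by (intro local_entropy_nonneg fin_codim_cotrajectory lc_open_subspaceD order_refl)

end

lemma topological_endoI:
  assumes "topological_vectorspace K V T" "linear_map K V V \<phi>" "continuous_map T T \<phi>"
  shows "topological_endo K V T \<phi>"
  using assms by (simp add: topological_endo_def topological_endo_axioms_def linear_endo_def
      topological_vs_def topological_vs_axioms_def topological_vectorspace_def)

text \<open>The indices vary independently, so each supremum is taken with the other summand fixed.
  In \<open>ereal\<close>, moving a sum into a supremum requires a nonempty index set and a fixed
  summand other than minus infinity.\<close>

lemma SUP_ereal_add_le:
  fixes f :: "'a \<Rightarrow> real" and g :: "'b \<Rightarrow> real"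
  assumes "A \<noteq> {}" "B \<noteq> {}" "\<And>x. x \<in> A \<Longrightarrow> 0 \<le> f x"
    and le: "\<And>x y. x \<in> A \<Longrightarrow> y \<in> B \<Longrightarrow> ereal (f x + g y) \<le> c"
  shows "(SUP x\<in>A. ereal (f x)) + (SUP y\<in>B. ereal (g y)) \<le> c"
proof -
  let ?S = "SUP y\<in>B. ereal (g y)"
  have S: "?S \<noteq> -\<infinity>"
  proof -
    obtain y where "y \<in> B" using assms(2) by blast
    then have "ereal (g y) \<le> ?S" by (rule SUP_upper)
    then show ?thesis by auto
  qed
  have "ereal (f x) + ?S \<le> c" if "x \<in> A" for x
  proof -
    have "ereal (f x) + ?S = (SUP y\<in>B. ereal (f x) + ereal (g y))"
      by (rule SUP_ereal_add_right[symmetric]) (use assms(2) in auto)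
    also have "\<dots> \<le> c" using le[OF that] by (intro SUP_least) simp
    finally show ?thesis .
  qed
  moreover have "(SUP x\<in>A. ereal (f x)) + ?S = (SUP x\<in>A. ereal (f x) + ?S)"
    by (rule SUP_ereal_add_left[symmetric]) (use assms(1) S in auto)
  ultimately show ?thesis by (simp add: SUP_least)
qed

theorem theorem1p2:
  fixes K :: "('k, 'l) ring_scheme" and V :: "('k, 'v, 'm) module_scheme"
    and T :: "'v topology" and \<phi> :: "'v \<Rightarrow> 'v" and W :: "'v set"
  assumes "locally_linearly_compact K V T"
    and "continuous_endomorphism K V T \<phi>"
    and "VectorSpace.subspace K W V"
    and "closedin T W"
    and "\<phi> ` W \<subseteq> W"
  shows "topological_entropy K V T \<phi> =
      topological_entropy K (V\<lparr>carrier := W\<rparr>) (subtopology T W) (restrict \<phi> W) +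
      topological_entropy K (quotient_space V W) (quotient_topology V T W)
        (quotient_endomorphism V W \<phi>)"
proof -
  note W = assms(3) and cl = assms(4) and inv = assms(5)
  have V: "topological_vectorspace K V T"
    using assms(1) by (simp add: locally_linearly_compact_def)
  have phi: "linear_map K V V \<phi>" "continuous_map T T \<phi>"
    using assms(2) by (auto simp: continuous_endomorphism_def)
  interpret V: topological_endo K V T \<phi> by (rule topological_endoI[OF V phi])
  interpret I: invariant_subspace K V \<phi> W
    by (intro invariant_subspace.intro invariant_subspace_axioms.intro V.linear_endo_axioms W inv)
  interpret Q: topological_vs_quotient K V T W
    by (intro topological_vs_quotient.intro topological_vs_quotient_axioms.intro V.topological_vs_axioms W)
  let ?VW = "quotient_space V W" and ?TW = "quotient_topology V T W"
    and ?\<psi> = "quotient_endomorphism V W \<phi>" and ?W = "V\<lparr>carrier := W\<rparr>" and ?TW' = "subtopology T W"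
  let ?p = "\<lambda>v. W +>\<^bsub>V\<^esub> v"
  \<comment> \<open>Since \<psi> after \<open>p\<close> is \<open>p\<close> after \<phi>, continuity
    descends along the quotient map.\<close>
  have "continuous_map T ?TW (?\<psi> \<circ> ?p)"
    by (rule continuous_map_eq[OF continuous_map_compose[OF phi(2) Q.continuous_p]])
      (simp add: V.topspace_eq I.\<psi>_p)
  then have "continuous_map ?TW ?TW ?\<psi>"
    by (rule continuous_compose_quotient_map[OF Q.quotient_map_p])
  then interpret E: topological_endo K ?VW ?TW ?\<psi>
    by (intro topological_endoI Q.topological_quotient I.\<psi>.linear_map_axioms)
  have "linear_map K ?W ?W (restrict \<phi> W)"
  proof -
    interpret R: linear_map K ?W ?W \<phi>
      by (rule V.linear_map_restrict[OF W W inv])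
    show ?thesis
      using inv V.subspaceD[OF W]
      by (intro linear_mapI) (auto simp: R.V.vectorspace_axioms V.T_add V.T_smult subset_iff)
  qed
  moreover have "continuous_map ?TW' ?TW' (restrict \<phi> W)"
  proof (rule continuous_map_eq)
    show "continuous_map ?TW' ?TW' \<phi>"
      using phi(2) inv by (auto simp: continuous_map_in_subtopology continuous_map_from_subtopology)
  qed simp
  ultimately interpret R: topological_endo K ?W ?TW' "restrict \<phi> W"
    by (intro topological_endoI V.topological_vectorspace_subspace W)
  have base: "\<exists>U\<in>V.B. U \<subseteq> N" if N: "openin T N" "\<zero>\<^bsub>V\<^esub> \<in> N" for N
  proof -
    have "neighbourhood_base_at \<zero>\<^bsub>V\<^esub> (\<lambda>U. U \<in> V.B) T"
      using assms(1) by (simp add: locally_linearly_compact_def)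
    from this[unfolded neighbourhood_base_at_def, rule_format, OF conjI[OF N]]
    show ?thesis by blast
  qed
  have lt: "linearly_topologized K ?VW ?TW"
    by (rule Q.linearly_topologized_quotient[OF cl]) (use base V.lc_open_subspaceD in blast)
  have BQ: "?p ` U \<in> E.B" and BR: "U \<inter> W \<in> R.B" if "U \<in> V.B" for U
    using Q.lc_open_subspaces_image[OF lt that] lc_open_subspaces_Int[OF V that W cl] by auto
  have RW: "U \<subseteq> W" if "U \<in> R.B" for U
    using R.subspaceD(1)[OF R.lc_open_subspaceD(1)[OF that]] by simp
  \<comment> \<open>The entropy bounds above are phrased inside \<open>V\<close>; this carries them
    to the restriction.\<close>
  have HR: "R.H U = V.H U" and CR: "cotrajectory (restrict \<phi> W) U n = cotrajectory \<phi> U n"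
    if "U \<in> R.B" for U n
    using local_entropy_restrict[OF inv RW[OF that]] cotrajectory_restrict[OF inv RW[OF that]] by auto
  have fin_R: "fin_codim K V U (cotrajectory \<phi> U n)" if "U \<in> R.B" for U n
    using R.fin_codim_cotrajectory[OF that that order_refl, of n] CR[OF that] by simp
  obtain U0 where U0: "U0 \<in> V.B"
    using base[OF openin_topspace] by (auto simp: V.topspace_eq)
  show ?thesis
  proof (rule antisym)
    show "topological_entropy K V T \<phi> \<le>
      topological_entropy K ?W ?TW' (restrict \<phi> W) + topological_entropy K ?VW ?TW ?\<psi>"
      (is "_ \<le> ?eR + ?eQ")
      unfolding topological_entropy_def[of K V]
    proof (rule SUP_least)
      fix U assume U: "U \<in> V.B"
      have R: "ereal (V.H (U \<inter> W)) \<le> ?eR"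
        unfolding topological_entropy_def HR[OF BR[OF U], symmetric] by (rule SUP_upper[OF BR[OF U]])
      have Q: "ereal (E.H Y) \<le> ?eQ" if "Y \<in> E.B" for Y
        unfolding topological_entropy_def by (rule SUP_upper[OF that])
      show "ereal (V.H U) \<le> ?eR + ?eQ"
      \<comment> \<open>The block estimate needs a real bound \<open>e\<close>, so an infinite
        supremum is treated apart.\<close>
      proof (cases "?eQ = \<infinity>")
        case True
        then show ?thesis using R by auto
      next
        case False
        \<comment> \<open>The image of \<open>U0\<close> shows that the supremum is not over the
          empty set, which excludes minus infinity.\<close>
        moreover have "0 \<le> ?eQ"
          using order_trans[OF _ Q[OF BQ[OF U0]], of 0] E.H_nonneg[OF BQ[OF U0]] by simp
        ultimately obtain e where e: "?eQ = ereal e" by (cases ?eQ) auto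
        have "V.H U \<le> V.H (U \<inter> W) + e"
        proof (rule I.local_entropy_le_add[OF V.lc_open_subspaceD(1)[OF U] fin_R[OF BR[OF U]]])
          fix m
          \<comment> \<open>Continuity of \<phi> makes the cotrajectory an open subspace, so it
            contains a member of \<open>V.B\<close>; that member serves as
            \<open>U'\<close>.\<close>
          have C: "V.sub (cotrajectory \<phi> U m)" "openin T (cotrajectory \<phi> U m)"
            using V.sub_cotrajectory V.openin_cotrajectory V.lc_open_subspaceD U by auto
          then obtain U' where U': "U' \<in> V.B" "U' \<subseteq> cotrajectory \<phi> U m"
            using base V.subspaceD(2) by blast
          have "U' \<subseteq> U" using U'(2) cotrajectory_subset[of \<phi> U m] by (rule subset_trans)
          moreover have "E.H (?p ` U') \<le> e" using Q[OF BQ[OF U'(1)]] e by simp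
          ultimately show "\<exists>U'. V.sub U' \<and> U' \<subseteq> cotrajectory \<phi> U m \<and>
            (\<forall>n. fin_codim K V U (cotrajectory \<phi> U' n)) \<and>
            (\<forall>n. fin_codim K ?VW (?p ` U') (cotrajectory ?\<psi> (?p ` U') n)) \<and> E.H (?p ` U') \<le> e"
            using U' by (intro exI[of _ U'] conjI allI V.lc_open_subspaceD(1) V.fin_codim_cotrajectory U
                E.fin_codim_cotrajectory BQ order_refl)
        qed
        then have "ereal (V.H U) \<le> ereal (V.H (U \<inter> W)) + ?eQ" using e by simp
        also have "\<dots> \<le> ?eR + ?eQ" by (rule add_right_mono[OF R])
        finally show ?thesis .
      qed
    qed
    show "topological_entropy K ?W ?TW' (restrict \<phi> W) + topological_entropy K ?VW ?TW ?\<psi> \<le>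
      topological_entropy K V T \<phi>"
      unfolding topological_entropy_def[of K ?W] topological_entropy_def[of K ?VW]
    proof (rule SUP_ereal_add_le)
      show "R.B \<noteq> {}" "E.B \<noteq> {}" using BR[OF U0] BQ[OF U0] by auto
      show "0 \<le> R.H U" if "U \<in> R.B" for U by (rule R.H_nonneg[OF that])
      fix U1 U2 assume U1: "U1 \<in> R.B" and U2: "U2 \<in> E.B"
      obtain G where G: "openin T G" "U1 = G \<inter> W"
        using R.lc_open_subspaceD(2)[OF U1] by (auto simp: openin_subtopology)
      \<comment> \<open>A single \<open>U\<close> inside this neighbourhood refines both choices: it
        meets \<open>W\<close> inside \<open>U1\<close>, and its image under \<open>p\<close> lies
        in \<open>U2\<close>.\<close>
      define N where "N = G \<inter> {v \<in> carrier V. ?p v \<in> U2}"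
      have "openin T N"
        using G E.lc_open_subspaceD(2)[OF U2] by (auto simp: N_def Q.openin_quotient_iff)
      moreover have "\<zero>\<^bsub>V\<^esub> \<in> N"
        using R.subspaceD(2)[OF R.lc_open_subspaceD(1)[OF U1]] I.p.W.subspaceD(2)[OF E.lc_open_subspaceD(1)[OF U2]] G(2)
          V.coset_zero[OF W] by (simp add: N_def)
      ultimately obtain U where U: "U \<in> V.B" "U \<subseteq> N" using base by blast
      have "R.H U1 \<le> R.H (U \<inter> W)"
        using U G(2) by (intro R.H_antimono U1 BR) (auto simp: N_def)
      moreover have "E.H U2 \<le> E.H (?p ` U)"
        using U by (intro E.H_antimono U2 BQ) (auto simp: N_def)
      moreover have "V.H (U \<inter> W) + E.H (?p ` U) \<le> V.H U"
        using V.lc_open_subspaceD(1)[OF U(1)] V.fin_codim_cotrajectory[OF U(1) U(1) order_refl]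
          E.fin_codim_cotrajectory[OF BQ[OF U(1)] BQ[OF U(1)] order_refl] fin_R[OF BR[OF U(1)]]
        by (rule I.local_entropy_add_le)
      ultimately have "ereal (R.H U1 + E.H U2) \<le> ereal (V.H U)"
        using HR[OF BR[OF U(1)]] by simp
      also have "\<dots> \<le> topological_entropy K V T \<phi>"
        unfolding topological_entropy_def by (rule SUP_upper[OF U(1)])
      finally show "ereal (R.H U1 + E.H U2) \<le> topological_entropy K V T \<phi>" .
    qed
  qed
qed

end
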